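(* Let $K$ be a balanced convex disk, with corresponding boundary trajectory $(g,X)$, and let $z$ be the trajectory in $\mathfrak h^\star$ defined by $\Phi\circ z=X$. If any point of the trajectory $z$ is not in $\mathfrak h^{\star\star}$, then the cost of the trajectory (the area of $K$) is strictly greater than the area of the smoothed octagon, $\sqrt{12}\,\frac{8-\sqrt{32}-\ln2}{\sqrt8-1}$. Hence $K$ is not a global minimizer of area among balanced disks.
   Context: Let $\mathbf s_j^*=(\cos(\pi j/3),\sin(\pi j/3))$, $j\in\mathbb Z/6\mathbb Z$. A multi-point is a map $j\mapsto\mathbf s_j\in\mathbb R^2$, $j\in\mathbb Z/6\mathbb Z$, with $\mathbf s_0+\mathbf s_2+\mathbf s_4=0$, $\mathbf s_{j+3}=-\mathbf s_j$, $\det(\mathbf s_j,\mathbf s_{j+1})=\sqrt3/2$ for all $j$. A compact convex set $K\subset\mathbb R^2$ with nonempty interior and $K=-K$ is balanced if its boundary is parameterized counterclockwise by six regular $C^1$ curves $\sigma_j:\mathbb R\to\mathbb R^2$ ($j\in\mathbb Z/6\mathbb Z$) such that: the derivatives $\sigma_j'$ are Lipschitz; for each $t$, $j\mapsto\sigma_j(t)$ is a multi-point; $\det(\sigma_j'(t),\sigma_j''(t))\ge0$ for almost all $t$; for each $t$ the vector $\sigma_j'(t)$ points into the open cone with apex $\sigma_j(t)$ and bounding rays through $\sigma_{j+1}(t)$ and $\sigma_j(t)+\sigma_{j+1}(t)$; and the images of all $\sigma_j:\mathbb R/(6t_f\mathbb Z)\to\mathbb R^2$ are the same simple closed curve, $6t_f$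 being the common period. Boundary trajectory: $g(t)\in\mathrm{SL}_2(\mathbb R)$ is determined by $\sigma_j(t)=g(t)\mathbf s_j^*$, and $X=g^{-1}g'\in\mathfrak{sl}_2(\mathbb R)$, where the parameter $t$ is chosen so that $\det X(t)=1$. The map $\Phi(x+iy)=\begin{pmatrix}x/y&-(x^2+y^2)/y\\1/y&-x/y\end{pmatrix}$ is a bijection from the upper half-plane $\mathfrak h$ onto $\{X\in\mathfrak{sl}_2(\mathbb R):\det X=1,\ \mathrm{trace}(JX)<0\}$, $J=\begin{pmatrix}0&-1\\1&0\end{pmatrix}$, and $X(t)=\Phi(z(t))$ with $z(t)$ in the star domain $\mathfrak h^\star=\{x+iy:y>0,|x|<1/\sqrt3,x^2+y^2>1/3\}$. The cost is $-\frac32\int_0^{t_f}\mathrm{trace}(JX)\,dt=\mathrm{area}(K)$. The compact set $\mathfrak h^{\star\star}$: let $B(i\infty)=\{y>4.5\}$, let $B(\pm1/\sqrt3)$ be the open Euclidean disks in $\mathfrak h$ with centers $\pm\frac1{\sqrt3}+\frac{4}{27}i$ and radius $\frac4{27}$, let $\Pi_0^+=\{x+iy\in\mathfrak h:y>15(1/\sqrt3-x)\}$, and let $\Pi_1^+,\Pi_2^+$ be the images of $\Pi_0^+$ under the linear fractional transformations of $\mathfrak h$ given by $R=\exp(J\pi/3)$ and $R^2$. Then $\mathfrak h^{\star\star}=\mathfrak h^\star\setminus(B(i\infty)\cup B(1/\sqrt3)\cup B(-1/\sqrt3)\cup\Pi_0^+\cup\Pi_1^+\cup\Pi_2^+)$.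 *)

theory Defs
  imports "HOL-Analysis.Analysis"
begin

definition det2 :: "real^2 \<Rightarrow> real^2 \<Rightarrow> real" where
  "det2 u v = det (vector [u, v] :: real^2^2)"

text \<open>
  Maps on the integers modulo 6 are rendered as 6-periodic maps on \<^typ>\<open>int\<close>.
\<close>

definition s_star :: "int \<Rightarrow> real^2" where
  "s_star j = vector [cos (pi * of_int j / 3), sin (pi * of_int j / 3)]"

definition multi_point :: "(int \<Rightarrow> real^2) \<Rightarrow> bool" where
  "multi_point s \<longleftrightarrow>
     (\<forall>j. s (j + 6) = s j) \<and>
     s 0 + s 2 + s 4 = 0 \<and>
     (\<forall>j. s (j + 3) = - s j) \<and>
     (\<forall>j. det2 (s j) (s (j + 1)) = sqrt 3 / 2)"

text \<open>The open cone with apex \<open>p\<close> and bounding rays through \<open>u\<close> and \<open>v\<close>.\<close>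

definition open_cone :: "real^2 \<Rightarrow> real^2 \<Rightarrow> real^2 \<Rightarrow> (real^2) set" where
  "open_cone p u v = {p + a *\<^sub>R (u - p) + b *\<^sub>R (v - p) | a b. a > 0 \<and> b > 0}"

text \<open>
  The curves \<open>\<sigma> j\<close> parameterize the boundary of \<open>K\<close> as required of a balanced disk, with
  common period \<open>6 * tf\<close>. As \<open>K\<close> is centrally symmetric, the origin is an interior point,
  and a boundary curve runs counterclockwise iff \<open>det2 (\<sigma> j t) (\<sigma>' j t) > 0\<close>.
  Since \<open>\<sigma>' j\<close> is Lipschitz, the second derivative exists almost everywhere, so the
  existential in the convexity condition adds no restriction. A vector \<open>w\<close> based at \<open>p\<close>
  points into an open cone with apex \<open>p\<close> iff \<open>p + w\<close> lies in that cone.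
\<close>

definition balanced_param ::
    "(real^2) set \<Rightarrow> (int \<Rightarrow> real \<Rightarrow> real^2) \<Rightarrow> real \<Rightarrow> bool" where
  "balanced_param K \<sigma> tf \<longleftrightarrow>
     (let \<sigma>' = (\<lambda>j t. vector_derivative (\<sigma> j) (at t)) in
       tf > 0 \<and>
       (\<forall>j. \<sigma> j C1_differentiable_on UNIV) \<and>
       (\<forall>j t. \<sigma>' j t \<noteq> 0) \<and>
       (\<forall>j. \<exists>L. L-lipschitz_on UNIV (\<sigma>' j)) \<and>
       (\<forall>t. multi_point (\<lambda>j. \<sigma> j t)) \<and>
       (\<forall>j. AE t in lebesgue.
          \<exists>w. (\<sigma>' j has_vector_derivative w) (at t) \<and> det2 (\<sigma>' j t) w \<ge> 0) \<and>
       (\<forall>j t. \<sigma> j t + \<sigma>' j t \<in>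
          open_cone (\<sigma> j t) (\<sigma> (j + 1) t) (\<sigma> j t + \<sigma> (j + 1) t)) \<and>
       (\<forall>j t. \<sigma> j (t + 6 * tf) = \<sigma> j t) \<and>
       (\<forall>j. inj_on (\<sigma> j) {0..<6 * tf}) \<and>
       (\<forall>j. range (\<sigma> j) = frontier K) \<and>
       (\<forall>j t. det2 (\<sigma> j t) (\<sigma>' j t) > 0))"

definition balanced_disk :: "(real^2) set \<Rightarrow> bool" where
  "balanced_disk K \<longleftrightarrow>
     compact K \<and> convex K \<and> interior K \<noteq> {} \<and> uminus ` K = K \<and>
     (\<exists>\<sigma> tf. balanced_param K \<sigma> tf)"

definition area :: "(real^2) set \<Rightarrow> real" where
  "area K = measure lebesgue K"

definition global_area_minimizer :: "(real^2) set \<Rightarrow> bool" where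
  "global_area_minimizer K \<longleftrightarrow>
     balanced_disk K \<and> (\<forall>K'. balanced_disk K' \<longrightarrow> area K \<le> area K')"

definition J_mat :: "real^2^2" where
  "J_mat = vector [vector [0, -1], vector [1, 0]]"

text \<open>
  \<open>\<sigma>\<close> is a parameterization of the boundary of \<open>K\<close> in the normalized parameter, i.e. the
  one with \<open>det (X t) = 1\<close>. The curve \<open>g\<close> is differentiable because \<open>\<sigma> 0\<close> and
  \<open>\<sigma> 1\<close> are.
\<close>

definition boundary_trajectory ::
    "(real^2) set \<Rightarrow> (int \<Rightarrow> real \<Rightarrow> real^2) \<Rightarrow> real \<Rightarrow>
     (real \<Rightarrow> real^2^2) \<Rightarrow> (real \<Rightarrow> real^2^2) \<Rightarrow> bool" where
  "boundary_trajectory K \<sigma> tf g X \<longleftrightarrow>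
     balanced_param K \<sigma> tf \<and>
     (\<forall>t. det (g t) = 1) \<and>
     (\<forall>j t. \<sigma> j t = g t *v s_star j) \<and>
     (\<forall>t. X t = matrix_inv (g t) ** vector_derivative g (at t)) \<and>
     (\<forall>t. det (X t) = 1)"

definition trajectory_cost :: "(real \<Rightarrow> real^2^2) \<Rightarrow> real \<Rightarrow> real" where
  "trajectory_cost X tf = - (3/2) * integral {0..tf} (\<lambda>t. trace (J_mat ** X t))"

definition upper_half_plane :: "complex set" where
  "upper_half_plane = {z. Im z > 0}"

definition \<Phi> :: "complex \<Rightarrow> real^2^2" where
  "\<Phi> z = vector [vector [Re z / Im z, - ((Re z)\<^sup>2 + (Im z)\<^sup>2) / Im z],
                 vector [1 / Im z, - Re z / Im z]]"

definition star_domain :: "complex set" where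
  "star_domain =
     {z \<in> upper_half_plane. \<bar>Re z\<bar> < 1 / sqrt 3 \<and> (Re z)\<^sup>2 + (Im z)\<^sup>2 > 1/3}"

definition matrix_exp :: "real^2^2 \<Rightarrow> real^2^2" where
  "matrix_exp A = (\<Sum>n. (((**) A) ^^ n) (mat 1) /\<^sub>R fact n)"

definition R_mat :: "real^2^2" where
  "R_mat = matrix_exp ((pi/3) *\<^sub>R J_mat)"

definition lin_frac :: "real^2^2 \<Rightarrow> complex \<Rightarrow> complex" where
  "lin_frac A z =
     (of_real (A $ 1 $ 1) * z + of_real (A $ 1 $ 2)) /
     (of_real (A $ 2 $ 1) * z + of_real (A $ 2 $ 2))"

definition B_infinity :: "complex set" where
  "B_infinity = {z. Im z > 9/2}"

definition B_cusp :: "real \<Rightarrow> complex set" where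
  "B_cusp c = ball (Complex c (4/27)) (4/27)"

definition Pi0_plus :: "complex set" where
  "Pi0_plus = {z \<in> upper_half_plane. Im z > 15 * (1 / sqrt 3 - Re z)}"

definition Pi1_plus :: "complex set" where
  "Pi1_plus = lin_frac R_mat ` Pi0_plus"

definition Pi2_plus :: "complex set" where
  "Pi2_plus = lin_frac (R_mat ** R_mat) ` Pi0_plus"

definition compact_star_domain :: "complex set" where
  "compact_star_domain =
     star_domain - (B_infinity \<union> B_cusp (1 / sqrt 3) \<union> B_cusp (- 1 / sqrt 3) \<union>
                    Pi0_plus \<union> Pi1_plus \<union> Pi2_plus)"

definition smoothed_octagon_area :: real where
  "smoothed_octagon_area = sqrt 12 * ((8 - sqrt 32 - ln 2) / (sqrt 8 - 1))"


definition complex_matrix :: "complex \<Rightarrow> real^2^2" where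
  "complex_matrix w = vector [vector [Re w, - Im w], vector [Im w, Re w]]"

lemma complex_matrix_mult: "complex_matrix v ** complex_matrix w = complex_matrix (v * w)"
  by (simp add: complex_matrix_def matrix_matrix_mult_def vec_eq_iff forall_2 sum_2)

lemma bounded_linear_complex_matrix: "bounded_linear complex_matrix"
  unfolding linear_conv_bounded_linear[symmetric]
  by (rule linearI) (simp_all add: complex_matrix_def vec_eq_iff forall_2)

lemma matrix_exp_complex_matrix: "matrix_exp (complex_matrix w) = complex_matrix (exp w)"
proof -
  have one: "complex_matrix 1 = mat 1"
    by (simp add: complex_matrix_def mat_def vec_eq_iff forall_2)
  have pow: "(((**) (complex_matrix w)) ^^ n) (mat 1) = complex_matrix (w ^ n)" for n
    by (induction n) (simp_all add: one complex_matrix_mult)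
  have "(\<lambda>n. complex_matrix (w ^ n /\<^sub>R fact n)) sums complex_matrix (exp w)"
    by (rule bounded_linear.sums[OF bounded_linear_complex_matrix exp_converges])
  then show ?thesis
    unfolding matrix_exp_def pow
    by (simp add: sums_iff linear_scale[OF bounded_linear.linear[OF bounded_linear_complex_matrix]])
qed

lemma R_mat_eq: "R_mat = vector [vector [1/2, - sqrt 3 / 2], vector [sqrt 3 / 2, 1/2]]"
proof -
  have "(pi/3) *\<^sub>R J_mat = complex_matrix (\<i> * of_real (pi/3))"
    by (simp add: J_mat_def complex_matrix_def vec_eq_iff forall_2)
  then have "R_mat = complex_matrix (cis (pi/3))"
    by (simp only: R_mat_def matrix_exp_complex_matrix cis_conv_exp)
  then show ?thesis
    by (simp add: complex_matrix_def cos_60 sin_60)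
qed

end

theory Submission
  imports Defs
begin

text \<open>
  The area exceeds \<open>\<pi>\<close>, the area of the unit disk; the unit disk is balanced and \<open>\<pi>\<close> exceeds the
  area of the smoothed octagon.

  A multi-point of \<open>K\<close> is determined by its first entry, and the normalization \<open>det X = 1\<close> then
  forces \<open>\<sigma> j (t + tf) = \<sigma> (j + 1) t\<close>. So \<open>z\<close> is equivariant under the rotation of order three, and
  one may assume that \<open>z\<close> enters the horoball \<open>y > 9/2\<close>, or the wall \<open>Pi0_plus\<close> while staying out
  of all three horoballs. In either case \<open>K\<close> is close to a parallelogram of area \<open>sqrt 12\<close>: normalize
  \<open>\<sigma> j\<close> to be the regular hexagon at this time, and bound the area of \<open>K\<close> from below by the polygon
  spanned by this hexagon and a few points \<open>\<sigma> j t\<close> near the corners of the parallelogram. The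
  tangent lines at the hexagon together with the equations \<open>det (\<sigma> i t, \<sigma> j t) = sqrt 3 / 2\<close> show that
  these points are indeed close to the corners.
\<close>

section \<open>Balanced curves\<close>

text \<open>Two limiting parallelograms stand behind the estimates, both of area
  \<open>sqrt 12\<close>, about 3.464. As \<open>z\<close> tends to infinity upwards, the tangents
  at \<sigma> 1 and \<sigma> 2 merge into one side and the tangent at \<sigma> 0 gives the next one.
  As \<open>x\<close> tends to \<open>1 / sqrt 3\<close>, the tangent at \<sigma> 0 becomes parallel
  to \<sigma> 1 and the tangent at \<sigma> 1 parallel to \<sigma> 0, so that \<sigma> 2 is itself a
  corner. The wall alone is not enough: near the cusps at its two ends the slope of one of these
  tangents is no longer small, hence the horoballs come first. The comparison with pi instead of the
  octagon (area about 3.126) avoids having to show that the octagon is balanced. The number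
  \<open>3.13\<close> separates the octagon from pi and \<open>3.15\<close> separates pi from both
  polygon bounds, so a loss of about 0.31 against the parallelogram is affordable.\<close>

lemma det2_eq: "det2 u v = u $ 1 * v $ 2 - u $ 2 * v $ 1"
  by (simp add: det2_def det_2)

lemma det2_simps:
  "det2 (u + v) w = det2 u w + det2 v w" "det2 w (u + v) = det2 w u + det2 w v"
  "det2 (u - v) w = det2 u w - det2 v w" "det2 w (u - v) = det2 w u - det2 w v"
  "det2 (- u) w = - det2 u w" "det2 w (- u) = - det2 w u"
  "det2 (c *\<^sub>R u) w = c * det2 u w" "det2 w (c *\<^sub>R u) = c * det2 w u"
  "det2 u u = 0" "det2 0 u = 0" "det2 u 0 = 0"
  by (simp_all add: det2_eq algebra_simps)

lemma det2_commute: "det2 u v = - det2 v u"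
  by (simp add: det2_eq)

lemma det2_matrix: "det2 (A *v u) (A *v v) = det A * det2 u v"
  by (simp add: det2_eq det_2 matrix_vector_mult_def sum_2 algebra_simps)

lemma bounded_bilinear_det2: "bounded_bilinear det2"
proof -
  have "det2 = (\<lambda>u v. u \<bullet> (\<chi> i. if i = 1 then v $ 2 else - v $ 1))"
    by (intro ext) (simp add: det2_eq inner_vec_def sum_2)
  moreover have "bounded_linear (\<lambda>v::real^2. (\<chi> i. if i = 1 then v $ 2 else - v $ 1) :: real^2)"
    unfolding linear_conv_bounded_linear[symmetric]
    by (rule linearI) (simp_all add: vec_eq_iff)
  ultimately show ?thesis
    using bounded_bilinear.comp[OF bounded_bilinear_inner bounded_linear_ident] by fastforce
qed

lemmas continuous_on_det2 [continuous_intros] =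
  bounded_bilinear.continuous_on[OF bounded_bilinear_det2]

lemma has_real_derivative_det2:
  assumes "(f has_vector_derivative f') (at t)" "(g has_vector_derivative g') (at t)"
  shows "((\<lambda>t. det2 (f t) (g t)) has_real_derivative det2 (f t) g' + det2 f' (g t)) (at t)"
  using bounded_bilinear.has_vector_derivative[OF bounded_bilinear_det2 assms]
  by (simp add: has_real_derivative_iff_has_vector_derivative)

lemma det2_eq_0_collinear:
  assumes "det2 u v = 0" "u \<noteq> 0"
  obtains c where "v = c *\<^sub>R u"
proof -
  have "u $ 1 \<noteq> 0 \<or> u $ 2 \<noteq> 0"
    using assms(2) by (simp add: vec_eq_iff forall_2)
  then have "v = (if u $ 1 \<noteq> 0 then v $ 1 / u $ 1 else v $ 2 / u $ 2) *\<^sub>R u"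
    using assms(1) by (auto simp: vec_eq_iff forall_2 det2_eq field_simps)
  with that show thesis .
qed

section \<open>Support lines and uniqueness of multi-points on the boundary of a balanced
  disk\<close>

locale balanced_curve =
  fixes K :: "(real^2) set" and \<sigma> :: "int \<Rightarrow> real \<Rightarrow> real^2" and tf :: real
  assumes compact_K: "compact K" and convex_K: "convex K" and interior_K: "interior K \<noteq> {}"
    and symmetric_K: "uminus ` K = K"
    and param: "balanced_param K \<sigma> tf"
begin

definition vel :: "int \<Rightarrow> real \<Rightarrow> real^2" where
  "vel j t = vector_derivative (\<sigma> j) (at t)"

lemma tf_pos: "tf > 0"
  using param by (simp add: balanced_param_def Let_def)

lemma has_vel: "(\<sigma> j has_vector_derivative vel j t) (at t)"
  using param unfolding balanced_param_def Let_def vel_def C1_differentiable_on_eq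
  by (simp add: vector_derivative_works)

lemma continuous_on_vel [continuous_intros]:
  assumes "continuous_on S f"
  shows "continuous_on S (\<lambda>x. vel j (f x))"
proof -
  have "continuous_on UNIV (vel j)"
    using param unfolding balanced_param_def Let_def vel_def C1_differentiable_on_eq by auto
  then show ?thesis
    using assms continuous_on_compose2 by blast
qed

lemma continuous_on_curve [continuous_intros]:
  assumes "continuous_on S f"
  shows "continuous_on S (\<lambda>x. \<sigma> j (f x))"
proof -
  have "continuous_on UNIV (\<sigma> j)"
    using has_vel by (meson continuous_at_imp_continuous_on has_vector_derivative_continuous)
  then show ?thesis
    using assms continuous_on_compose2 by blast
qed

lemma multi: "multi_point (\<lambda>j. \<sigma> j t)"
  using param by (simp add: balanced_param_def Let_def)

lemma curve_6: "\<sigma> (j + 6) t = \<sigma> j t"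
  and curve_3: "\<sigma> (j + 3) t = - \<sigma> j t"
  and det_curve: "det2 (\<sigma> j t) (\<sigma> (j + 1) t) = sqrt 3 / 2"
  using multi[of t] by (auto simp: multi_point_def)

text \<open>The vanishing sum is given for a single triple of indices; \<open>curve_3\<close>
  carries the resulting recurrence one index up or down.\<close>

lemma curve_2: "\<sigma> (j + 2) t = \<sigma> (j + 1) t - \<sigma> j t"
proof (induction j rule: int_induct[of _ 0])
  case base
  have "\<sigma> 4 t = - \<sigma> 1 t" using curve_3[of 1 t] by simp
  moreover have "\<sigma> 0 t + \<sigma> 2 t + \<sigma> 4 t = 0" using multi[of t] by (simp add: multi_point_def)
  ultimately show ?case by (simp add: algebra_simps)
next
  case (step1 i)
  then show ?case using curve_3[of i t] by (simp add: algebra_simps)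
next
  case (step2 i)
  then show ?case using curve_3[of "i - 1" t] by (simp add: algebra_simps)
qed

lemma det_curve_2: "det2 (\<sigma> j t) (\<sigma> (j + 2) t) = sqrt 3 / 2"
  by (simp add: curve_2 det2_simps det_curve)

lemma curve_nz: "\<sigma> j t \<noteq> 0"
  using det_curve[of j t] by (auto simp: det2_simps)

lemma curve_period: "\<sigma> j (t + 6 * tf) = \<sigma> j t"
  using param by (simp add: balanced_param_def Let_def)

lemma inj_curve: "inj_on (\<sigma> j) {0..<6 * tf}"
  using param by (simp add: balanced_param_def Let_def)

lemma range_curve: "range (\<sigma> j) = frontier K"
  using param by (simp add: balanced_param_def Let_def)

lemma ccw: "det2 (\<sigma> j t) (vel j t) > 0"
  using param by (simp add: balanced_param_def Let_def vel_def)

lemma curve_in_frontier: "\<sigma> j t \<in> frontier K"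
  using range_curve by blast

lemma curve_in_K: "\<sigma> j t \<in> K"
  using curve_in_frontier compact_K by (metis compact_imp_closed frontier_subset_closed subsetD)

text \<open>The edge \<open>\<sigma> (j + 2) t - \<sigma> (j + 1) t\<close> of the cone equals
  \<open>- \<sigma> j t\<close>, so the determinant only sees the positive coefficient of
  \<open>\<sigma> (j + 2) t\<close>. Thus the tangent at \<open>\<sigma> (j + 1) t\<close> is never
  parallel to \<open>\<sigma> j t\<close>, which \<open>next_unique\<close> relies on.\<close>

lemma cone: "det2 (\<sigma> j t) (vel (j + 1) t) > 0"
proof -
  have "\<sigma> (j+1) t + vel (j+1) t \<in> open_cone (\<sigma> (j+1) t) (\<sigma> (j+1+1) t) (\<sigma> (j+1) t + \<sigma> (j+1+1) t)"
    using param unfolding balanced_param_def Let_def vel_def by blast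
  then obtain a b where ab: "a > 0" "b > 0"
    "vel (j+1) t = a *\<^sub>R (\<sigma> (j+2) t - \<sigma> (j+1) t) + b *\<^sub>R \<sigma> (j+2) t"
    by (auto simp: open_cone_def add.assoc)
  then have "det2 (\<sigma> j t) (vel (j + 1) t) = b * (sqrt 3 / 2)"
    by (simp add: det2_simps det_curve_2 det_curve)
  with ab(1,2) show ?thesis by (simp only: mult_pos_pos) simp
qed

lemma zero_interior: "0 \<in> interior K"
proof -
  obtain x where x: "x \<in> interior K" using interior_K by auto
  have "uminus ` interior K = interior (uminus ` K)"
    by (rule interior_negations[symmetric])
  then have "- x \<in> interior K"
    using x symmetric_K by force
  moreover have "0 = (1/2) *\<^sub>R x + (1/2) *\<^sub>R (- x)" by simp
  ultimately show ?thesis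
    using x convex_interior[OF convex_K] unfolding convex_def
    by (metis add_divide_distrib divide_self_if one_add_one zero_le_divide_1_iff zero_le_numeral zero_neq_numeral)
qed

text \<open>\<open>K\<close> lies to the left of each oriented tangent. A supporting functional
  \<open>a\<close> at the boundary point is minimal along the curve there, so it annihilates the
  velocity and is a multiple \<open>c\<close> of \<open>det2 (vel j t)\<close>. The sign of
  \<open>c\<close> follows from the interior origin and the counterclockwise orientation.\<close>

lemma support:
  assumes "k \<in> K"
  shows "det2 (vel j t) k \<ge> det2 (vel j t) (\<sigma> j t)"
proof -
  let ?p = "\<sigma> j t" and ?w = "vel j t"
  have "?p \<notin> rel_interior K"
    using curve_in_frontier[of j t] interior_K
    by (simp add: frontier_def rel_interior_nonempty_interior)
  then obtain a where a0: "a \<noteq> 0" and a: "\<And>y. y \<in> K \<Longrightarrow> a \<bullet> ?p \<le> a \<bullet> y"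
    using supporting_hyperplane_rel_boundary[OF convex_K curve_in_K] by metis
  have "a \<bullet> ?w = 0"
  proof -
    have "((\<lambda>s. a \<bullet> \<sigma> j s) has_real_derivative a \<bullet> ?w) (at t)"
      using bounded_linear.has_vector_derivative[OF bounded_linear_inner_right has_vel]
      by (simp add: has_real_derivative_iff_has_vector_derivative)
    then show ?thesis
      by (rule DERIV_local_min[of _ _ _ 1]) (auto intro: a curve_in_K)
  qed
  define b :: "real^2" where "b = vector [a $ 2, - a $ 1]"
  have ab: "a \<bullet> y = det2 y b * (- 1)" for y
    by (simp add: b_def inner_vec_def sum_2 det2_eq algebra_simps)
  have "?w \<noteq> 0" using ccw[of j t] by (auto simp: det2_simps)
  then obtain c where c: "b = c *\<^sub>R ?w"
    using \<open>a \<bullet> ?w = 0\<close> ab det2_eq_0_collinear[of ?w b] by auto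
  have a2: "a \<bullet> y = c * det2 ?w y" for y
    unfolding ab c by (simp add: det2_simps det2_commute[of y])
  obtain e where e: "e > 0" "cball 0 e \<subseteq> K"
    using zero_interior by (meson mem_interior_cball)
  have "- (e / norm a) *\<^sub>R a \<in> K"
    using e a0 by (intro subsetD[OF e(2)]) simp
  then have "a \<bullet> ?p \<le> - (e / norm a) * (a \<bullet> a)" using a by fastforce
  also have "\<dots> < 0" using e a0 by simp
  finally have "c * det2 ?w ?p < 0" by (simp add: a2)
  moreover have "det2 ?w ?p < 0" using ccw[of j t] by (simp add: det2_commute[of ?w])
  ultimately have "c > 0" by (simp add: mult_less_0_iff)
  with a[OF assms] show ?thesis by (simp add: a2)
qed

text \<open>The tangent at the inner of two boundary points on one ray would cut off the outer
  one.\<close>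

lemma ray_unique:
  assumes "\<sigma> i t = r *\<^sub>R \<sigma> j s" "r > 0"
  shows "r = 1"
proof -
  have *: "r \<le> 1" if "\<sigma> i t = r *\<^sub>R \<sigma> j s" for r i j t s
  proof -
    have "det2 (vel j s) (r *\<^sub>R \<sigma> j s) \<ge> det2 (vel j s) (\<sigma> j s)"
      using support[OF curve_in_K[of i t], of j s] that by simp
    moreover have "det2 (vel j s) (\<sigma> j s) < 0"
      using ccw[of j s] by (simp add: det2_commute[of "vel j s"])
    ultimately show ?thesis by (simp add: det2_simps)
  qed
  have "\<sigma> j s = (1 / r) *\<^sub>R \<sigma> i t" using assms by simp
  from *[OF this] *[OF assms(1)] assms(2) show ?thesis by simp
qed

text \<open>The determinant with \<open>\<sigma> i t\<close> fixes the next point up to a multiple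
  \<open>c\<close> of \<open>\<sigma> i t\<close>. If \<open>c > 0\<close>, the points
  \<open>\<sigma> (i + 1) t + c *\<^sub>R \<sigma> i t\<close> and
  \<open>\<sigma> (i + 2) t = \<sigma> (i + 1) t - \<sigma> i t\<close> of \<open>K\<close> lie on
  opposite sides of \<open>\<sigma> (i + 1) t\<close> on a line, so the tangent there is this line,
  against \<open>cone\<close>. Exchanging the two multi-points excludes
  \<open>c < 0\<close>.\<close>

lemma next_unique:
  assumes "\<sigma> i t = \<sigma> j s"
  shows "\<sigma> (i + 1) t = \<sigma> (j + 1) s"
proof -
  have *: "c \<le> 0" if p: "\<sigma> i t = \<sigma> j s" and c: "\<sigma> (j + 1) s = \<sigma> (i + 1) t + c *\<^sub>R \<sigma> i t" for c i j t s
  proof (rule ccontr)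
    assume "\<not> c \<le> 0"
    then have c0: "c > 0" by simp
    let ?w = "vel (i + 1) t"
    have "det2 ?w (\<sigma> (i+2) t) \<ge> det2 ?w (\<sigma> (i+1) t)"
      by (rule support[OF curve_in_K])
    then have "det2 ?w (\<sigma> i t) \<le> 0" by (simp add: curve_2 det2_simps)
    moreover have "det2 ?w (\<sigma> (j+1) s) \<ge> det2 ?w (\<sigma> (i+1) t)"
      by (rule support[OF curve_in_K])
    then have "c * det2 ?w (\<sigma> i t) \<ge> 0" by (simp add: c det2_simps)
    then have "det2 ?w (\<sigma> i t) \<ge> 0" using c0 by (simp add: zero_le_mult_iff)
    ultimately have "det2 (\<sigma> i t) ?w = 0" by (simp add: det2_commute[of "\<sigma> i t"])
    with cone[of i t] show False by simp
  qed
  have "det2 (\<sigma> i t) (\<sigma> (j + 1) s - \<sigma> (i + 1) t) = 0"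
    using det_curve[of i t] det_curve[of j s] assms by (simp add: det2_simps)
  then obtain c where c: "\<sigma> (j + 1) s - \<sigma> (i + 1) t = c *\<^sub>R \<sigma> i t"
    using curve_nz det2_eq_0_collinear by metis
  have "c \<le> 0" using c by (intro *[OF assms]) (simp add: algebra_simps)
  moreover have "- c \<le> 0" using c assms
    by (intro *[OF assms[symmetric]]) (simp add: algebra_simps)
  ultimately show ?thesis using c by simp
qed

lemma next_unique_n:
  assumes "\<sigma> i t = \<sigma> j s"
  shows "\<sigma> (i + int n) t = \<sigma> (j + int n) s"
proof (induction n)
  case (Suc n)
  then show ?case using next_unique[OF Suc] by (simp add: algebra_simps)
qed (use assms in simp)

end

section \<open>The rotation of the parameter\<close>

context balanced_curve
begin

lemma curve_period_int: "\<sigma> j (t + 6 * tf * of_int k) = \<sigma> j t"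
proof (induction k rule: int_induct[of _ 0])
  case base
  show ?case by simp
next
  case (step1 i)
  then show ?case using curve_period[of j "t + 6 * tf * of_int i"] by (simp add: algebra_simps)
next
  case (step2 i)
  then show ?case using curve_period[of j "t + 6 * tf * of_int (i - 1)"] by (simp add: algebra_simps)
qed

lemma curve_6_int: "\<sigma> (j + 6 * k) t = \<sigma> j t"
proof (induction k rule: int_induct[of _ 0])
  case base
  show ?case by simp
next
  case (step1 i)
  then show ?case using curve_6[of "j + 6 * i" t] by (simp add: algebra_simps)
next
  case (step2 i)
  then show ?case using curve_6[of "j + 6 * (i - 1)" t] by (simp add: algebra_simps)
qed

lemma curve_3_neq: "\<sigma> (j + 3) t \<noteq> \<sigma> j t"
  using det_curve[of j t] det2_simps(5)[of "\<sigma> j t" "\<sigma> (j + 1) t"] curve_3[of j t]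
  by (metis equal_neg_zero divide_eq_0_iff real_sqrt_eq_0_iff zero_neq_numeral)

lemma window: "\<exists>k::int. t - 6 * tf * of_int k \<in> {a..<a + 6 * tf}"
proof
  have "of_int \<lfloor>(t - a) / (6 * tf)\<rfloor> \<le> (t - a) / (6 * tf)"
    "(t - a) / (6 * tf) < of_int \<lfloor>(t - a) / (6 * tf)\<rfloor> + 1" by linarith+
  then have "of_int \<lfloor>(t - a) / (6 * tf)\<rfloor> * (6 * tf) \<le> t - a"
    "t - a < (of_int \<lfloor>(t - a) / (6 * tf)\<rfloor> + 1) * (6 * tf)"
    using tf_pos by (simp_all only: pos_le_divide_eq pos_divide_less_eq mult_pos_pos zero_less_numeral)
  then show "t - 6 * tf * of_int \<lfloor>(t - a) / (6 * tf)\<rfloor> \<in> {a..<a + 6 * tf}"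
    by (simp add: algebra_simps)
qed

lemma curve_eqD:
  assumes "\<sigma> j t = \<sigma> j s"
  shows "\<exists>k. s = t + 6 * tf * of_int k"
proof -
  obtain k l where kl: "t - 6 * tf * of_int k \<in> {0..<6 * tf}" "s - 6 * tf * of_int l \<in> {0..<6 * tf}"
    using window[of t 0] window[of s 0] by auto
  have "\<sigma> j (t - 6 * tf * of_int k) = \<sigma> j (s - 6 * tf * of_int l)"
    using curve_period_int[of j t "- k"] curve_period_int[of j s "- l"] assms by simp
  then have "t - 6 * tf * of_int k = s - 6 * tf * of_int l"
    using inj_onD[OF inj_curve] kl by blast
  then have "s = t + 6 * tf * of_int (l - k)" by (simp add: algebra_simps)
  then show ?thesis ..
qed

lemma curve_neq:
  assumes "s < t" "t < s + 6 * tf"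
  shows "\<sigma> j s \<noteq> \<sigma> j t"
proof
  assume "\<sigma> j s = \<sigma> j t"
  then obtain k where k: "t = s + 6 * tf * of_int k" using curve_eqD by blast
  then have "0 < tf * of_int k" "tf * of_int k < tf * 1" using assms tf_pos by auto
  then have "0 < (of_int k::real)" "of_int k < (1::real)"
    using tf_pos by (simp_all only: zero_less_mult_pos mult_less_cancel_left_pos)
  then show False by simp
qed

lemma curve_onto_window:
  assumes "p \<in> frontier K"
  shows "\<exists>u\<in>{a..<a + 6 * tf}. \<sigma> j u = p"
proof -
  obtain s where s: "\<sigma> j s = p" using assms range_curve[of j] by (metis rangeE)
  obtain k where k: "s - 6 * tf * of_int k \<in> {a..<a + 6 * tf}" using window by blast
  moreover have "\<sigma> j (s - 6 * tf * of_int k) = p"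
    using curve_period_int[of j s "- k"] s by simp
  ultimately show ?thesis by blast
qed

lemma next_unique_int:
  assumes "\<sigma> i t = \<sigma> j s"
  shows "\<sigma> (i + m) t = \<sigma> (j + m) s"
proof -
  define n where "n = nat (m mod 6)"
  have "m = int n + 6 * (m div 6)" by (simp add: n_def)
  then show ?thesis
    using next_unique_n[OF assms, of n] curve_6_int[of "i + int n" "m div 6" t]
      curve_6_int[of "j + int n" "m div 6" s] by (metis add.assoc)
qed

lemma curve_collinear:
  assumes "det2 (\<sigma> i s) (\<sigma> j t) = 0"
  shows "\<sigma> j t = \<sigma> i s \<or> \<sigma> j t = \<sigma> (i + 3) s"
proof -
  obtain c where c: "\<sigma> j t = c *\<^sub>R \<sigma> i s"
    using assms curve_nz det2_eq_0_collinear by metis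
  then have "c \<noteq> 0" using curve_nz by auto
  then consider "c > 0" | "- c > 0" by linarith
  then show ?thesis
  proof cases
    case 1
    with c ray_unique[of j t c i s] show ?thesis by simp
  next
    case 2
    with c ray_unique[of j t "- c" "i + 3" s] show ?thesis by (simp add: curve_3)
  qed
qed

text \<open>The determinant with \<open>\<sigma> j s\<close> increases from 0 at time
  \<open>s\<close>, so it can only become nonpositive through a zero, and a zero is a return to the
  starting point or its antipode.\<close>

lemma det_nonpos_hits:
  assumes "s < u" "det2 (\<sigma> j s) (\<sigma> j u) \<le> 0"
  shows "\<exists>v. s < v \<and> v \<le> u \<and> (\<sigma> j v = \<sigma> j s \<or> \<sigma> j v = \<sigma> (j + 3) s)"
proof -
  let ?g = "\<lambda>t. det2 (\<sigma> j s) (\<sigma> j t)"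
  have "(?g has_real_derivative det2 (\<sigma> j s) (vel j s)) (at s)"
    using has_real_derivative_det2[OF has_vector_derivative_const has_vel]
    by (simp add: det2_simps)
  from DERIV_pos_inc_right[OF this ccw] obtain d where d: "d > 0"
    "\<And>h. h > 0 \<Longrightarrow> h < d \<Longrightarrow> ?g (s + h) > 0" by (auto simp: det2_simps)
  obtain e where "0 < e" "e < min d (u - s)"
    using dense[of 0 "min d (u - s)"] d(1) assms(1) by auto
  then have e: "e > 0" "e < d" "s + e \<le> u" by simp_all
  then have "?g (s + e) > 0" using d by auto
  then obtain v where "s + e \<le> v" "v \<le> u" "?g v = 0"
    using IVT2'[of ?g u 0 "s + e"] e assms(2) by (force intro!: continuous_intros)
  then show ?thesis using curve_collinear[of j s j v] e by force
qed

end

text \<open>The form that \<open>det X = 1\<close> takes on the velocities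
  \<open>g *v (X *v s_star j)\<close>; it frees the geometric part from \<open>g\<close> and
  \<open>X\<close>.\<close>

locale normalized_curve = balanced_curve +
  assumes det_vel: "det2 (vel j t) (vel (j + 1) t) = sqrt 3 / 2"
begin

text \<open>Both \<open>\<sigma> 0\<close> and \<open>\<sigma> 1\<close> run through the same closed curve, so \<open>\<sigma> 1 t = \<sigma> 0 (\<phi> t)\<close>; the
  normalization of the speed forces \<open>\<phi>' = 1\<close>.\<close>

lemma ex_shift: "\<exists>c. 0 < c \<and> c < 6 * tf \<and> (\<forall>j t. \<sigma> j (t + c) = \<sigma> (j + 1) t)"
proof -
  have neq: "\<sigma> 0 t \<noteq> \<sigma> 1 t" for t
    using det_curve[of 0 t] by (auto simp: det2_simps)
  have "\<exists>u. t < u \<and> u < t + 6 * tf \<and> \<sigma> 0 u = \<sigma> 1 t" for t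
    using curve_onto_window[OF curve_in_frontier, of t 0 1 t] neq[of t]
    by (metis atLeastLessThan_iff order_le_less)
  then obtain \<phi> where \<phi>: "\<And>t. t < \<phi> t" "\<And>t. \<phi> t < t + 6 * tf" "\<And>t. \<sigma> 0 (\<phi> t) = \<sigma> 1 t"
    by metis
  \<comment> \<open>The window is closed, although its ends are never attained, so that the graph of
    \<phi> below is a closed set.\<close>
  have uniq: "u = \<phi> t" if "t \<le> u" "u \<le> t + 6 * tf" "\<sigma> 0 u = \<sigma> 1 t" for t u
  proof (rule ccontr)
    assume "u \<noteq> \<phi> t"
    moreover have "u \<noteq> t" "u \<noteq> t + 6 * tf" using neq[of t] that(3) curve_period[of 0 t] by auto
    ultimately show False
      using curve_neq[of u "\<phi> t" 0] curve_neq[of "\<phi> t" u 0] \<phi>[of t] that by force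
  qed
  have cont: "continuous_on {a..b} \<phi>" for a b
  proof (rule continuous_from_closed_graph)
    show "compact {a..b + 6 * tf}" by simp
    show "\<phi> \<in> {a..b} \<rightarrow> {a..b + 6 * tf}"
    proof
      fix x assume "x \<in> {a..b}"
      then show "\<phi> x \<in> {a..b + 6 * tf}" using \<phi>(1)[of x] \<phi>(2)[of x] by simp
    qed
    have "(\<lambda>x. (x, \<phi> x)) ` {a..b} =
      {p. a \<le> fst p \<and> fst p \<le> b \<and> fst p \<le> snd p \<and> snd p \<le> fst p + 6 * tf \<and>
        \<sigma> 0 (snd p) = \<sigma> 1 (fst p)}" (is "_ = ?G")
    proof (intro set_eqI iffI)
      fix p assume "p \<in> ?G"
      then have p: "a \<le> fst p" "fst p \<le> b" "fst p \<le> snd p" "snd p \<le> fst p + 6 * tf"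
        "\<sigma> 0 (snd p) = \<sigma> 1 (fst p)" by blast+
      have "snd p = \<phi> (fst p)" by (rule uniq[OF p(3-5)])
      then have "p = (fst p, \<phi> (fst p))" by (simp add: prod_eq_iff)
      moreover have "fst p \<in> {a..b}" using p(1,2) by simp
      ultimately show "p \<in> (\<lambda>x. (x, \<phi> x)) ` {a..b}" by (rule image_eqI)
    next
      fix p assume "p \<in> (\<lambda>x. (x, \<phi> x)) ` {a..b}"
      then obtain x where "p = (x, \<phi> x)" "x \<in> {a..b}" by auto
      then show "p \<in> ?G" using \<phi>(1)[of x] \<phi>(2)[of x] \<phi>(3)[of x] by simp
    qed
    moreover have "closed ?G"
      by (intro closed_Collect_conj closed_Collect_le closed_Collect_eq continuous_intros)
    ultimately show "closed ((\<lambda>x. (x, \<phi> x)) ` {a..b})" by simp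
  qed
  have isCont: "isCont \<phi> t" for t
    using continuous_on_interior[OF cont[of "t - 1" "t + 1"], of t] by simp
  have deriv: "(\<phi> has_real_derivative 1) (at t)" for t
  proof -
    \<comment> \<open>Pairing with this velocity gives a scalar function of nonzero derivative at
      \<open>\<phi> t\<close>; Caratheodory's form of the derivative then makes \<phi>
      differentiable from its continuity alone.\<close>
    let ?w = "vel 0 (\<phi> t)"
    have w0: "?w \<noteq> 0" using ccw[of 0 "\<phi> t"] by (auto simp: det2_simps)
    have inn: "((\<lambda>s. ?w \<bullet> \<sigma> j s) has_real_derivative ?w \<bullet> vel j s) (at s)" for j s
      using bounded_linear.has_vector_derivative[OF bounded_linear_inner_right has_vel]
      by (simp add: has_real_derivative_iff_has_vector_derivative)
    obtain G where G: "\<And>z. ?w \<bullet> \<sigma> 0 z - ?w \<bullet> \<sigma> 0 (\<phi> t) = G z * (z - \<phi> t)"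
      "isCont G (\<phi> t)" "G (\<phi> t) = ?w \<bullet> ?w"
      using inn[of 0 "\<phi> t"] unfolding CARAT_DERIV by blast
    obtain H where H: "\<And>z. ?w \<bullet> \<sigma> 1 z - ?w \<bullet> \<sigma> 1 t = H z * (z - t)" "isCont H t"
      using inn[of 1 t] unfolding CARAT_DERIV by blast
    have GH: "G (\<phi> z) * (\<phi> z - \<phi> t) = H z * (z - t)" for z
      using G(1)[of "\<phi> z"] H(1)[of z] by (simp add: \<phi>(3))
    have G\<phi>: "(\<lambda>z. G (\<phi> z)) \<midarrow>t\<rightarrow> ?w \<bullet> ?w"
      using isCont_o2[OF isCont G(2)] G(3) by (simp add: isCont_def)
    then have ev: "\<forall>\<^sub>F z in at t. G (\<phi> z) \<noteq> 0"
      using w0 by (intro tendsto_imp_eventually_ne) auto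
    define p where "p = H t / (?w \<bullet> ?w)"
    have "((\<lambda>z. H z / G (\<phi> z)) \<longlongrightarrow> p) (at t)"
      unfolding p_def using H(2) w0 by (intro tendsto_divide G\<phi>) (auto simp: isCont_def)
    moreover have "\<forall>\<^sub>F z in at t. H z / G (\<phi> z) = (\<phi> z - \<phi> t) / (z - t)"
      using ev eventually_neq_at_within[of t t]
    proof eventually_elim
      case (elim z)
      with GH[of z] show ?case by (simp add: field_simps)
    qed
    ultimately have p: "(\<phi> has_real_derivative p) (at t)"
      by (simp add: has_field_derivative_iff cong: tendsto_cong)
    have nxt: "\<sigma> j (\<phi> s) = \<sigma> (j + 1) s" for j s
      using next_unique_int[of 0 "\<phi> s" 1 s j] \<phi>(3)[of s] by (simp add: add.commute)
    have v: "p *\<^sub>R vel j (\<phi> t) = vel (j + 1) t" for j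
    proof -
      have "((\<sigma> j \<circ> \<phi>) has_vector_derivative p *\<^sub>R vel j (\<phi> t)) (at t)"
        by (intro vector_diff_chain_at has_vel)
          (use p in \<open>simp add: has_real_derivative_iff_has_vector_derivative\<close>)
      moreover have "\<sigma> j \<circ> \<phi> = \<sigma> (j + 1)" using nxt by auto
      ultimately show ?thesis using has_vel vector_derivative_unique_at by metis
    qed
    \<comment> \<open>The normalization holds at time \<open>t\<close> and at time
      \<open>\<phi> t\<close>, and the two velocity determinants differ by the factor
      \<open>p * p\<close>. Orientation then selects \<open>p = 1\<close>.\<close>
    have "p * p = 1"
    proof -
      have "det2 (p *\<^sub>R vel 0 (\<phi> t)) (p *\<^sub>R vel 1 (\<phi> t)) = sqrt 3 / 2"
        using det_vel[of 1 t] v[of 0] v[of 1] by simp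
      then have "(p * p) * det2 (vel 0 (\<phi> t)) (vel 1 (\<phi> t)) = sqrt 3 / 2"
        by (simp add: det2_simps)
      moreover have "sqrt 3 / 2 \<noteq> (0::real)" by simp
      ultimately show ?thesis
        using det_vel[of 0 "\<phi> t"] by (metis add_0 mult_cancel_right1)
    qed
    moreover have "p > 0"
    proof -
      have "p * det2 (\<sigma> 0 (\<phi> t)) (vel 0 (\<phi> t)) = det2 (\<sigma> 1 t) (vel 1 t)"
        using v[of 0] nxt[of 0 t] det2_simps(8)[of "\<sigma> 1 t" p "vel 0 (\<phi> t)"] by simp
      then show ?thesis using ccw[of 0 "\<phi> t"] ccw[of 1 t] by (metis zero_less_mult_pos2)
    qed
    ultimately have "p = 1" using square_eq_1_iff[of p] by auto
    with p show ?thesis by simp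
  qed
  have "((\<lambda>t. \<phi> t - t) has_real_derivative 0) (at t)" for t
    using DERIV_diff[OF deriv DERIV_ident] by simp
  then have "\<phi> t - t = \<phi> 0 - 0" for t
    by (intro DERIV_isconst_all[rule_format]) auto
  then have \<phi>c: "\<phi> t = t + \<phi> 0" for t by (metis add.commute diff_add_cancel diff_zero)
  show ?thesis
  proof (intro exI conjI allI)
    show "0 < \<phi> 0" "\<phi> 0 < 6 * tf" using \<phi>(1,2)[of 0] by auto
    show "\<sigma> j (t + \<phi> 0) = \<sigma> (j + 1) t" for j t
      using next_unique_int[of 0 "\<phi> t" 1 t j] \<phi>(3)[of t] \<phi>c[of t] by (simp add: add.commute)
  qed
qed

text \<open>Six shifts by \<open>c\<close> return to the start, so \<open>c = k * tf\<close> with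
  \<open>0 < k < 6\<close>. For \<open>k\<close> equal to 2, 3 or 4, already two or three shifts
  make up whole periods, which identifies distinct entries of a multi-point. For
  \<open>k = 5\<close> time \<open>tf\<close> would move the index backwards: the curve would pass
  its start or antipode by time \<open>tf\<close>, although it is injective and meets the antipode
  at \<open>3 * tf\<close>.\<close>

lemma shift: "\<sigma> j (t + tf) = \<sigma> (j + 1) t"
proof -
  obtain c where c: "0 < c" "c < 6 * tf" "\<And>j t. \<sigma> j (t + c) = \<sigma> (j + 1) t"
    using ex_shift by blast
  have cn: "\<sigma> j (t + of_nat n * c) = \<sigma> (j + int n) t" for j n t
  proof (induction n arbitrary: j)
    case (Suc n)
    have "\<sigma> j (t + of_nat (Suc n) * c) = \<sigma> j ((t + of_nat n * c) + c)" by (simp add: algebra_simps)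
    then show ?case using c(3)[of j "t + of_nat n * c"] Suc[of "j + 1"] by (simp add: algebra_simps)
  qed simp
  have "\<sigma> 0 (0 + 6 * c) = \<sigma> 0 0" using cn[of 0 0 6] curve_6[of 0 0] by simp
  then obtain k where k: "6 * c = 6 * tf * of_int k"
    using curve_eqD[of 0 0 "6 * c"] by force
  then have ck: "c = tf * of_int k" by simp
  have "0 < tf * real_of_int k" "tf * real_of_int k < tf * 6"
    using ck c(1,2) by (simp_all add: mult.commute)
  then have "0 < real_of_int k" "real_of_int k < 6"
    using tf_pos zero_less_mult_pos mult_less_cancel_left_pos by blast+
  then have "0 < k" "k < 6" by linarith+
  then consider "k = 1" | "k = 2" | "k = 3" | "k = 4" | "k = 5" by linarith
  then show ?thesis
  proof cases
    case 1
    then show ?thesis using c(3) ck by simp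
  next
    case 2
    then have "\<sigma> 3 0 = \<sigma> 0 0"
      using cn[of 0 0 3] ck curve_period[of 0 0] by (simp add: mult.commute)
    then show ?thesis using curve_3_neq[of 0 0] by simp
  next
    case 3
    then have "\<sigma> 2 0 = \<sigma> 0 0"
      using cn[of 0 0 2] ck curve_period[of 0 0] by (simp add: mult.commute)
    then show ?thesis using det_curve_2[of 0 0] by (simp add: det2_simps)
  next
    case 4
    then have "\<sigma> 3 0 = \<sigma> 0 0"
      using cn[of 0 0 3] ck curve_period_int[of 0 0 2] by (simp add: mult.commute)
    then show ?thesis using curve_3_neq[of 0 0] by simp
  next
    case 5
    have rev1: "\<sigma> j (t + tf) = \<sigma> (j - 1) t" for j t
      using c(3)[of "j - 1" "t + tf"] curve_period[of "j - 1" t] ck 5 by (simp add: algebra_simps)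
    have rev3: "\<sigma> 0 (0 + 3 * tf) = \<sigma> 3 0"
      using rev1[of 0 "2 * tf"] rev1[of "-1" tf] rev1[of "-2" 0] curve_6[of "-3" 0]
      by (simp add: algebra_simps)
    have "(0::real) \<le> sqrt 3 / 2" by simp
    then have "det2 (\<sigma> (-1) 0) (\<sigma> 0 0) \<ge> 0" 
      using det_curve[of "-1" 0] by (metis add.left_inverse)
    then have "det2 (\<sigma> 0 0) (\<sigma> 0 tf) \<le> 0"
      using rev1[of 0 0] det2_commute[of "\<sigma> 0 0" "\<sigma> (-1) 0"] by simp
    then obtain v where v: "0 < v" "v \<le> tf" "\<sigma> 0 v = \<sigma> 0 0 \<or> \<sigma> 0 v = \<sigma> 3 0"
      using det_nonpos_hits[of 0 tf 0] tf_pos by auto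
    then show ?thesis
      using curve_neq[of 0 v 0] curve_neq[of v "3 * tf" 0] rev3 tf_pos by force
  qed
qed

lemma shift_3: "\<sigma> j (t + 3 * tf) = - \<sigma> j t"
  using shift[of j "t + 2 * tf"] shift[of "j + 1" "t + tf"] shift[of "j + 2" t] curve_3[of j t]
  by (simp add: algebra_simps)

text \<open>By \<open>shift_3\<close> the antipode is reached exactly after half a period, so
  injectivity forbids an earlier sign change.\<close>

lemma det_pos:
  assumes "s < u" "u < s + 3 * tf"
  shows "det2 (\<sigma> j s) (\<sigma> j u) > 0"
proof (rule ccontr)
  assume "\<not> ?thesis"
  then obtain v where v: "s < v" "v \<le> u" "\<sigma> j v = \<sigma> j s \<or> \<sigma> j v = \<sigma> j (s + 3 * tf)"
    using det_nonpos_hits[OF assms(1), of j] by (auto simp: shift_3 curve_3)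
  then show False
    using curve_neq[of s v j] curve_neq[of v "s + 3 * tf" j] assms tf_pos by auto
qed

end

section \<open>The area as an integral\<close>

context balanced_curve
begin

lemma radial_decomposition:
  assumes "k \<in> K"
  shows "k \<in> frontier K \<or> k = 0 \<or> (\<exists>u\<in>{a..<a + 6 * tf}. \<exists>r. 0 < r \<and> r < 1 \<and> k = r *\<^sub>R \<sigma> j u)"
proof -
  have "\<exists>u\<in>{a..<a + 6 * tf}. \<exists>r. 0 < r \<and> r < 1 \<and> k = r *\<^sub>R \<sigma> j u"
    if nf: "k \<notin> frontier K" and nz: "k \<noteq> 0"
  proof -
    have int: "k \<in> interior K"
      using nf assms closure_subset by (auto simp: frontier_def)
    obtain d where d: "d > 0" "0 + d *\<^sub>R k \<in> frontier K"
      using ray_to_frontier[OF compact_imp_bounded[OF compact_K] zero_interior nz] by blast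
    have "d > 1"
    proof (rule ccontr)
      assume "\<not> d > 1"
      then have "(1 - d) *\<^sub>R 0 + d *\<^sub>R k \<in> interior K"
        using d(1) int zero_interior convex_interior[OF convex_K] unfolding convex_alt
        by (metis less_imp_le not_le)
      then show False using d(2) by (simp add: frontier_def)
    qed
    obtain u where u: "u \<in> {a..<a + 6 * tf}" "\<sigma> j u = d *\<^sub>R k"
      using curve_onto_window[of "d *\<^sub>R k" a j] d(2) by auto
    then have "k = (1 / d) *\<^sub>R \<sigma> j u" using d(1) by simp
    then show ?thesis using u(1) \<open>d > 1\<close> by (intro bexI[of _ u] exI[of _ "1 / d"]) auto
  qed
  then show ?thesis by blast
qed

lemma scaled_curve_in_K:
  assumes "0 \<le> r" "r \<le> 1"
  shows "r *\<^sub>R \<sigma> j u \<in> K"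
proof -
  have "(1 - r) *\<^sub>R 0 + r *\<^sub>R \<sigma> j u \<in> K"
    using assms convex_K curve_in_K[of j u] zero_interior interior_subset
    unfolding convex_alt by (metis subsetD)
  then show ?thesis by simp
qed

text \<open>In the coordinates \<open>(r\<^sup>2, W)\<close>, where \<open>W\<close> is twice the swept area, the polar
  parameterization \<open>r \<sigma>\<close> of \<open>K\<close> has the constant Jacobian \<open>1/2\<close>.\<close>

lemma area_eq_integral:
  "measure lebesgue K = integral {a..a + 6 * tf} (\<lambda>t. det2 (\<sigma> j t) (vel j t)) / 2"
proof -
  define b where "b = a + 6 * tf"
  have ab: "a < b" using tf_pos by (simp add: b_def)
  define w where "w t = det2 (\<sigma> j t) (vel j t)" for t
  define W where "W t = integral {a..t} w" for t
  define M where "M = W b"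
  have wpos: "w t > 0" for t using ccw by (simp add: w_def)
  have contw: "continuous_on S w" for S unfolding w_def by (intro continuous_intros)
  have W': "(W has_real_derivative w t) (at t within {a..b})" if "t \<in> {a..b}" for t
    unfolding W_def using that contw by (intro integral_has_real_derivative)
  have contW: "continuous_on {a..b} W"
    using W' by (meson DERIV_continuous continuous_on_eq_continuous_within)
  have W'': "(W has_real_derivative w t) (at t)" if "a < t" "t < b" for t
    using W'[of t] that by (simp add: at_within_Icc_at)
  have mono: "W s < W t" if "a \<le> s" "s < t" "t \<le> b" for s t
  proof (rule DERIV_pos_imp_increasing_open[OF that(2)])
    show "\<exists>y. DERIV W x :> y \<and> y > 0" if "s < x" "x < t" for x
      using W''[of x] wpos[of x] that \<open>a \<le> s\<close> \<open>t \<le> b\<close> by force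
    show "continuous_on {s..t} W"
      using contW that by (auto intro: continuous_on_subset)
  qed
  have W0: "W a = 0" by (simp add: W_def)
  have M0: "M > 0" using mono[of a b] ab W0 by (simp add: M_def)
  have injW: "inj_on W {a..b}"
    by (rule inj_onI) (metis atLeastAtMost_iff linorder_neqE_linordered_idom mono order_less_irrefl)
  have imW: "W ` {a..b} = {0..M}"
  proof
    show "W ` {a..b} \<subseteq> {0..M}"
      using mono W0 unfolding M_def by (force simp: order_le_less)
    show "{0..M} \<subseteq> W ` {a..b}"
    proof
      fix y assume "y \<in> {0..M}"
      then obtain x where "a \<le> x" "x \<le> b" "W x = y"
        using IVT'[of W a y b] W0 ab contW by (auto simp: M_def)
      then show "y \<in> W ` {a..b}" by auto
    qed
  qed
  define \<psi> where "\<psi> = inv_into {a..b} W"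
  have \<psi>W: "\<psi> (W t) = t" if "a \<le> t" "t \<le> b" for t
    using injW that by (simp add: \<psi>_def)
  have W\<psi>: "W (\<psi> y) = y" "a \<le> \<psi> y" "\<psi> y \<le> b" if "y \<in> {0..M}" for y
    using that imW f_inv_into_f[of y W "{a..b}"] inv_into_into[of y W "{a..b}"]
    by (auto simp: \<psi>_def)
  have \<psi>_in: "a < \<psi> y" "\<psi> y < b" if "0 < y" "y < M" for y
    using W\<psi>[of y] that W0 M_def by (force simp: order_le_less)+
  have W_in: "0 < W t" "W t < M" if "a < t" "t < b" for t
    using mono[of a t] mono[of t b] that W0 M_def by auto
  have cont\<psi>: "continuous_on {0..M} \<psi>"
    using continuous_on_inv[OF contW compact_Icc, of \<psi>] \<psi>W imW by auto
  have \<psi>': "(\<psi> has_real_derivative inverse (w (\<psi> y))) (at y)" if "0 < y" "y < M" for y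
  proof (rule DERIV_inverse_function)
    show "DERIV W (\<psi> y) :> w (\<psi> y)" by (intro W'' \<psi>_in that)
    show "w (\<psi> y) \<noteq> 0" using wpos[of "\<psi> y"] by simp
    show "0 < y" "y < M" by fact+
    show "W (\<psi> z) = z" if "0 < z" "z < M" for z using W\<psi> that by simp
    show "isCont \<psi> y" using cont\<psi> that by (simp add: continuous_on_interior)
  qed
  define S :: "(real^2) set" where "S = box (vector [0, 0]) (vector [1, M])"
  have S: "v \<in> S \<longleftrightarrow> 0 < v $ 1 \<and> v $ 1 < 1 \<and> 0 < v $ 2 \<and> v $ 2 < M" for v
    by (auto simp: S_def mem_box_cart forall_2)
  define f where "f v = sqrt (v $ 1) *\<^sub>R \<sigma> j (\<psi> (v $ 2))" for v :: "real^2"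
  define f' where "f' v x = (x $ 1 * (inverse (sqrt (v $ 1)) / 2)) *\<^sub>R \<sigma> j (\<psi> (v $ 2))
    + sqrt (v $ 1) *\<^sub>R (x $ 2 * inverse (w (\<psi> (v $ 2)))) *\<^sub>R vel j (\<psi> (v $ 2))" for v x :: "real^2"
  have nth: "((\<lambda>v::real^2. v $ i) has_derivative (\<lambda>v. v $ i)) (at v)" for v i
    by (rule bounded_linear_imp_has_derivative[OF bounded_linear_vec_nth])
  have der: "(f has_derivative f' v) (at v)" if "v \<in> S" for v
  proof -
    have v: "0 < v $ 1" "0 < v $ 2" "v $ 2 < M" using that S by auto
    have "((\<lambda>v::real^2. sqrt (v $ 1)) has_derivative (\<lambda>x. x $ 1 * (inverse (sqrt (v $ 1)) / 2))) (at v)"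
      by (rule has_derivative_compose[OF nth
            DERIV_real_sqrt[OF v(1), unfolded has_field_derivative_def], THEN has_derivative_eq_rhs])
        (simp add: mult.commute)
    moreover have "((\<lambda>v::real^2. \<psi> (v $ 2)) has_derivative (\<lambda>x. x $ 2 * inverse (w (\<psi> (v $ 2))))) (at v)"
      by (rule has_derivative_compose[OF nth \<psi>'[OF v(2,3), unfolded has_field_derivative_def],
            THEN has_derivative_eq_rhs]) (simp add: mult.commute)
    from has_derivative_compose[OF this has_vel[of j, unfolded has_vector_derivative_def]]
    have "((\<lambda>v::real^2. \<sigma> j (\<psi> (v $ 2))) has_derivative
      (\<lambda>x. (x $ 2 * inverse (w (\<psi> (v $ 2)))) *\<^sub>R vel j (\<psi> (v $ 2)))) (at v)" .
    ultimately show ?thesis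
      unfolding f_def
      by (rule has_derivative_scaleR[THEN has_derivative_eq_rhs]) (simp add: f'_def fun_eq_iff)
  qed
  have jac: "\<bar>det (matrix (f' v))\<bar> = 1 / 2" if "v \<in> S" for v
  proof -
    have v: "sqrt (v $ 1) \<noteq> 0" "w (\<psi> (v $ 2)) \<noteq> 0" using that S wpos[of "\<psi> (v $ 2)"] by auto
    have "det (matrix (f' v)) = det2 (f' v (axis 1 1)) (f' v (axis 2 1))"
      by (simp add: det_2 det2_eq matrix_def)
    also have "\<dots> = (inverse (sqrt (v $ 1)) / 2) * (sqrt (v $ 1) * inverse (w (\<psi> (v $ 2)))) * w (\<psi> (v $ 2))"
      by (simp add: f'_def det2_simps w_def axis_def)
    also have "\<dots> = 1 / 2" using v by (simp add: field_simps)
    finally show ?thesis by simp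
  qed
  have inj: "inj_on f S"
  proof (rule inj_onI)
    fix u v assume uv: "u \<in> S" "v \<in> S" "f u = f v"
    then have r: "sqrt (u $ 1) > 0" "sqrt (v $ 1) > 0" using S by auto
    define q where "q = sqrt (v $ 1) / sqrt (u $ 1)"
    have "inverse (sqrt (u $ 1)) *\<^sub>R f u = inverse (sqrt (u $ 1)) *\<^sub>R f v" by (simp add: uv(3))
    then have e: "\<sigma> j (\<psi> (u $ 2)) = q *\<^sub>R \<sigma> j (\<psi> (v $ 2))"
      using r by (simp add: f_def q_def divide_inverse mult.commute)
    have q: "q = 1" by (rule ray_unique[OF e]) (use r in \<open>simp add: q_def\<close>)
    have "a < \<psi> (u $ 2)" "\<psi> (u $ 2) < b" "a < \<psi> (v $ 2)" "\<psi> (v $ 2) < b"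
      using \<psi>_in[of "u $ 2"] \<psi>_in[of "v $ 2"] uv(1,2) unfolding S by blast+
    moreover have "\<sigma> j (\<psi> (u $ 2)) = \<sigma> j (\<psi> (v $ 2))" "\<sigma> j (\<psi> (v $ 2)) = \<sigma> j (\<psi> (u $ 2))"
      using e q by simp_all
    ultimately have "\<not> \<psi> (u $ 2) < \<psi> (v $ 2)" "\<not> \<psi> (v $ 2) < \<psi> (u $ 2)"
      using curve_neq[of "\<psi> (u $ 2)" "\<psi> (v $ 2)" j] curve_neq[of "\<psi> (v $ 2)" "\<psi> (u $ 2)" j]
      unfolding b_def by argo+
    then have "\<psi> (u $ 2) = \<psi> (v $ 2)" by linarith
    moreover have "W (\<psi> (u $ 2)) = u $ 2" "W (\<psi> (v $ 2)) = v $ 2"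
      using uv(1,2) unfolding S by (simp_all add: W\<psi>(1))
    ultimately have "u $ 2 = v $ 2" by metis
    moreover have "u $ 1 = v $ 1" using q r by (simp add: q_def)
    ultimately show "u = v" by (simp add: vec_eq_iff forall_2)
  qed
  have bd: "bounded K" using compact_K by (rule compact_imp_bounded)
  have meas: "measure lebesgue (f ` S) = M / 2"
  proof -
    have "((\<lambda>x::real^2. 1 / 2 :: real) has_integral (1 / 2) * measure lborel (cbox (vector [0, 0]) (vector [1, M]) :: (real^2) set))
        (cbox (vector [0, 0]) (vector [1, M]))"
      using has_integral_const[of "1/2::real" "vector [0, 0] :: real^2" "vector [1, M]"]
      by (simp add: mult.commute)
    moreover have "measure lborel (cbox (vector [0, 0]) (vector [1, M]) :: (real^2) set) = M"
    proof (subst content_cbox_cart)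
      have "(vector [0, 0] :: real^2) \<in> cbox (vector [0, 0]) (vector [1, M])"
        using M0 by (simp add: mem_box_cart forall_2)
      then show "cbox (vector [0, 0]) (vector [1, M] :: real^2) \<noteq> {}" by blast
    qed (simp add: UNIV_2)
    ultimately have "((\<lambda>x. 1 / 2 :: real) has_integral M / 2) S"
      by (simp add: S_def has_integral_open_interval)
    then have "((\<lambda>x. \<bar>det (matrix (f' x))\<bar>) has_integral M / 2) S"
      by (rule has_integral_eq[rotated]) (simp add: jac)
    then show ?thesis
      using has_measure_differentiable_image[of S f f' "M / 2"] der inj
      by (simp add: S_def has_derivative_at_withinI)
  qed
  have sub: "f ` S \<subseteq> K"
  proof
    fix k assume "k \<in> f ` S"
    then show "k \<in> K" unfolding f_def using S by (auto intro!: scaled_curve_in_K)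
  qed
  \<comment> \<open>Besides boundary points, the open box only misses the origin and the ray where
    the parameter window is cut; both lie on one line through the origin.\<close>
  have sup: "K - f ` S \<subseteq> frontier K \<union> {v. vector [- \<sigma> j a $ 2, \<sigma> j a $ 1] \<bullet> v = 0}"
  proof
    fix k assume k: "k \<in> K - f ` S"
    show "k \<in> frontier K \<union> {v. vector [- \<sigma> j a $ 2, \<sigma> j a $ 1] \<bullet> v = 0}"
    proof (rule ccontr)
      assume n: "\<not> ?thesis"
      then have "k \<noteq> 0" "k \<notin> frontier K" by auto
      then obtain u r where u: "u \<in> {a..<a + 6 * tf}" "0 < r" "r < 1" "k = r *\<^sub>R \<sigma> j u"
        using radial_decomposition[of k a j] k by blast
      have "u \<noteq> a" using n u by (auto simp: inner_vec_def sum_2)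
      then have "a < u" "u < b" using u(1) by (auto simp: b_def)
      moreover have "r\<^sup>2 < 1" using u by (simp add: abs_square_less_1)
      ultimately have "k = f (vector [r\<^sup>2, W u])" "vector [r\<^sup>2, W u] \<in> S"
        using u W_in[of u] by (auto simp: f_def S \<psi>W)
      then show False using k by auto
    qed
  qed
  have "negligible (frontier K \<union> {v. vector [- \<sigma> j a $ 2, \<sigma> j a $ 1] \<bullet> v = (0::real)})"
  proof (intro negligible_Un negligible_convex_frontier convex_K negligible_hyperplane)
    show "vector [- \<sigma> j a $ 2, \<sigma> j a $ 1] \<noteq> (0::real^2) \<or> (0::real) \<noteq> 0"
      using curve_nz[of j a] by (auto simp: vec_eq_iff forall_2)
  qed
  then have "negligible (K - f ` S)" using sup negligible_subset by blast
  moreover have "f ` S - K = {}" using sub by auto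
  ultimately have "measure lebesgue (f ` S) = measure lebesgue K"
    by (intro measure_negligible_symdiff[OF lmeasurable_compact[OF compact_K]]) simp
  with meas show ?thesis by (simp add: M_def W_def w_def[abs_def] b_def)
qed

end

section \<open>Polygonal lower bounds in a normalized frame\<close>

context normalized_curve
begin

lemma vel_shift: "vel j (t + tf) = vel (j + 1) t"
proof -
  have "((\<lambda>s. \<sigma> j (s + tf)) has_vector_derivative 1 *\<^sub>R vel j (t + tf)) (at t)"
    by (rule vector_diff_chain_at[of "\<lambda>s. s + tf" 1 t "\<sigma> j", unfolded o_def])
      (auto intro!: has_vel derivative_eq_intros)
  then have "(\<sigma> (j + 1) has_vector_derivative vel j (t + tf)) (at t)"
    by (simp add: shift)
  then show ?thesis using has_vel vector_derivative_unique_at by blast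
qed

lemma vel_3: "vel (j + 3) t = - vel j t"
proof -
  have "\<sigma> (j + 3) = (\<lambda>t. - \<sigma> j t)" by (simp add: fun_eq_iff curve_3)
  then show ?thesis
    using has_vector_derivative_minus[OF has_vel[of j t]] has_vel[of "j + 3" t]
      vector_derivative_unique_at by metis
qed

definition rate :: "int \<Rightarrow> real \<Rightarrow> real" where
  "rate j t = det2 (\<sigma> j t) (vel j t)"

lemma continuous_on_rate: "continuous_on S (rate j)"
  unfolding rate_def by (intro continuous_intros)

lemma rate_integrable: "rate j integrable_on {a..b}"
  by (intro integrable_continuous_real continuous_on_rate)

lemma rate_3: "rate (j + 3) = rate j"
  by (simp add: rate_def fun_eq_iff curve_3 vel_3 det2_simps)

lemma integral_rate_shift: "integral {a + tf..b + tf} (rate j) = integral {a..b} (rate (j + 1))"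
proof -
  have "integral {a..b} (rate j \<circ> (\<lambda>x. x + tf)) = integral {a + tf..b + tf} (rate j)"
    by (rule integral_shift[OF continuous_on_rate])
  moreover have "rate j \<circ> (\<lambda>x. x + tf) = rate (j + 1)"
    by (simp add: rate_def fun_eq_iff shift vel_shift)
  ultimately show ?thesis by simp
qed

text \<open>One period of \<open>rate 0\<close> consists of the rates 0 to 5 over a window of length
  \<open>tf\<close>, and opposite indices agree. The resulting factor 2 cancels the 1/2 in
  \<open>area_eq_integral\<close>.\<close>

lemma area_eq_sixth:
  "measure lebesgue K = integral {a..a + tf} (rate 0) + integral {a..a + tf} (rate 1)
    + integral {a..a + tf} (rate 2)"
proof -
  let ?I = "\<lambda>j. integral {a..a + tf} (rate j)"
  have piece: "integral {a + of_nat n * tf..a + of_nat (Suc n) * tf} (rate j) = ?I (j + int n)" for n j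
  proof (induction n arbitrary: j)
    case (Suc n)
    show ?case
      using integral_rate_shift[of "a + of_nat n * tf" "a + of_nat (Suc n) * tf" j] Suc[of "j + 1"]
      by (simp add: algebra_simps)
  qed simp
  have "integral {a..a + of_nat n * tf} (rate 0) = (\<Sum>k<n. ?I (int k))" for n
  proof (induction n)
    case (Suc n)
    have "integral {a..a + of_nat n * tf} (rate 0)
        + integral {a + of_nat n * tf..a + of_nat (Suc n) * tf} (rate 0)
      = integral {a..a + of_nat (Suc n) * tf} (rate 0)"
      using tf_pos by (intro Henstock_Kurzweil_Integration.integral_combine rate_integrable) auto
    then show ?case using Suc piece[of n 0] by simp
  qed simp
  from this[of 6] have "integral {a..a + 6 * tf} (rate 0) = (\<Sum>k<6. ?I (int k))" by simp
  also have "\<dots> = 2 * (?I 0 + ?I 1 + ?I 2)"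
    using rate_3[of 0] rate_3[of 1] rate_3[of 2] by (simp add: eval_nat_numeral)
  finally show ?thesis
    using area_eq_integral[of a 0] by (simp add: rate_def[abs_def])
qed

text \<open>Both sides are doubled areas: a triangle over the chord and the sector over the arc. By
  \<open>support\<close>, \<open>\<sigma> j a\<close> lies to the left of the tangent at time
  \<open>t\<close>, which compares the integrands.\<close>

lemma arc_ge_triangle:
  assumes "a \<le> b"
  shows "det2 (\<sigma> j a) (\<sigma> j b) \<le> integral {a..b} (rate j)"
proof -
  have "((\<lambda>t. det2 (\<sigma> j a) (vel j t)) has_integral det2 (\<sigma> j a) (\<sigma> j b) - det2 (\<sigma> j a) (\<sigma> j a)) {a..b}"
  proof (rule fundamental_theorem_of_calculus[OF assms])
    fix t
    have "((\<lambda>t. det2 (\<sigma> j a) (\<sigma> j t)) has_real_derivative det2 (\<sigma> j a) (vel j t)) (at t)"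
      using has_real_derivative_det2[OF has_vector_derivative_const has_vel]
      by (simp add: det2_simps)
    then show "((\<lambda>t. det2 (\<sigma> j a) (\<sigma> j t)) has_vector_derivative det2 (\<sigma> j a) (vel j t)) (at t within {a..b})"
      by (simp add: has_real_derivative_iff_has_vector_derivative has_vector_derivative_at_within)
  qed
  moreover have "(rate j has_integral integral {a..b} (rate j)) {a..b}"
    using rate_integrable by (simp add: integrable_integral)
  moreover have "det2 (\<sigma> j a) (vel j t) \<le> rate j t" for t
    using support[OF curve_in_K[of j a], of j t]
      det2_commute[of "vel j t" "\<sigma> j a"] det2_commute[of "vel j t" "\<sigma> j t"]
    by (simp add: rate_def)
  ultimately show ?thesis
    using has_integral_le by (metis (no_types, lifting) det2_simps(9) diff_zero)
qed

lemma arc_ge_two_triangles: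
  assumes "a \<le> c" "c \<le> b"
  shows "det2 (\<sigma> j a) (\<sigma> j c) + det2 (\<sigma> j c) (\<sigma> j b) \<le> integral {a..b} (rate j)"
  using arc_ge_triangle[OF assms(1), of j] arc_ge_triangle[OF assms(2), of j]
    Henstock_Kurzweil_Integration.integral_combine[OF assms rate_integrable[of j]] by simp

text \<open>A centrally symmetric polygon with twelve vertices: each arc from
  \<open>\<sigma> j a\<close> to \<open>\<sigma> (j + 1) a\<close> is replaced by two chords. Three
  arcs suffice, since their doubled triangles make up the whole polygon.\<close>

lemma polygon_area_bound:
  assumes "a \<le> t" "t \<le> a + tf" "a \<le> t'" "t' \<le> a + tf" "a \<le> t''" "t'' \<le> a + tf"
  shows "det2 (\<sigma> 0 a) (\<sigma> 0 t) + det2 (\<sigma> 0 t) (\<sigma> 1 a)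
    + det2 (\<sigma> 1 a) (\<sigma> 1 t') + det2 (\<sigma> 1 t') (\<sigma> 2 a)
    + det2 (\<sigma> 2 a) (\<sigma> 2 t'') + det2 (\<sigma> 2 t'') (\<sigma> 3 a) \<le> measure lebesgue K"
  using arc_ge_two_triangles[OF assms(1,2), of 0] arc_ge_two_triangles[OF assms(3,4), of 1]
    arc_ge_two_triangles[OF assms(5,6), of 2] shift[of 0 a] shift[of 1 a] shift[of 2 a]
    area_eq_sixth[of a]
  by simp

end

text \<open>The frame \<open>B\<close> is the inverse of \<open>g(a)\<close>, and \<open>x + iy\<close> is the point of the upper half-plane
  at time \<open>a\<close>.\<close>

locale framed_curve = normalized_curve +
  fixes a x y :: real and B :: "real^2^2"
  assumes det_B: "det B = 1"
    and frame_0: "B *v \<sigma> 0 a = vector [1, 0]"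
    and frame_1: "B *v \<sigma> 1 a = vector [1/2, sqrt 3 / 2]"
    and frame_vel_0: "B *v vel 0 a = vector [x / y, 1 / y]"
    and frame_vel_1: "B *v vel 1 a
      = vector [(x / 2 - (x\<^sup>2 + y\<^sup>2) * (sqrt 3 / 2)) / y, (1/2 - x * (sqrt 3 / 2)) / y]"
    and y_pos: "y > 0"
begin

definition P :: "int \<Rightarrow> real \<Rightarrow> real" where "P j t = (B *v \<sigma> j t) $ 1"
definition Q :: "int \<Rightarrow> real \<Rightarrow> real" where "Q j t = (B *v \<sigma> j t) $ 2"

lemma det2_frame: "det2 u v = (B *v u) $ 1 * (B *v v) $ 2 - (B *v u) $ 2 * (B *v v) $ 1"
  using det2_matrix[of B u v] det_B by (simp add: det2_eq)

lemma det2_frame_divide: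
  assumes "B *v w = vector [p / y, q / y]"
  shows "y * det2 w u = p * (B *v u) $ 2 - q * (B *v u) $ 1"
  using y_pos by (simp add: det2_frame assms right_diff_distrib)

lemma det2_PQ: "det2 (\<sigma> i s) (\<sigma> j t) = P i s * Q j t - Q i s * P j t"
  by (simp add: det2_frame P_def Q_def)

lemma continuous_on_PQ: "continuous_on S (P j)" "continuous_on S (Q j)"
  unfolding P_def Q_def
  by (intro continuous_on_component bounded_linear.continuous_on[OF matrix_vector_mul_bounded_linear]
      continuous_intros)+

lemma PQ_2: "P 2 t = P 1 t - P 0 t" "Q 2 t = Q 1 t - Q 0 t"
  using curve_2[of 0 t] by (simp_all add: P_def Q_def matrix_vector_mult_diff_distrib)

lemma PQ_3: "P 3 t = - P 0 t" "Q 3 t = - Q 0 t"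
  using curve_3[of 0 t] by (simp_all add: P_def Q_def matrix_vector_mult_def sum_2)

lemma PQ_start: "P 0 a = 1" "Q 0 a = 0" "P 1 a = 1/2" "Q 1 a = sqrt 3 / 2"
  "P 2 a = - 1/2" "Q 2 a = sqrt 3 / 2" "P 3 a = - 1" "Q 3 a = 0"
  by (simp_all add: PQ_2 PQ_3) (simp_all add: P_def Q_def frame_0 frame_1)

lemma PQ_end: "P j (a + tf) = P (j + 1) a" "Q j (a + tf) = Q (j + 1) a"
  by (simp_all add: P_def Q_def shift)

lemma PQ_det: "P 0 t * Q 1 t - Q 0 t * P 1 t = sqrt 3 / 2"
  using det_curve[of 0 t] by (simp add: det2_PQ)

lemma vel_2: "vel 2 t = vel 1 t - vel 0 t"
proof -
  have "((\<lambda>t. \<sigma> 1 t - \<sigma> 0 t) has_vector_derivative vel 1 t - vel 0 t) (at t)"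
    by (intro has_vector_derivative_diff has_vel)
  moreover have "(\<lambda>t. \<sigma> 1 t - \<sigma> 0 t) = \<sigma> 2" using curve_2[of 0] by auto
  ultimately show ?thesis using has_vel vector_derivative_unique_at by metis
qed

text \<open>The tangent at \<open>\<sigma> 0 a\<close> in frame coordinates, a line through
  \<open>(1, 0)\<close> of direction \<open>(x, 1)\<close>. The next two lemmas treat the tangents
  at \<open>\<sigma> 1 a\<close> and \<open>\<sigma> 2 a\<close>.\<close>

lemma support_0: "P j t - 1 \<le> x * Q j t"
proof -
  have "det2 (vel 0 a) (\<sigma> 0 a) \<le> det2 (vel 0 a) (\<sigma> j t)" by (rule support[OF curve_in_K])
  then show ?thesis
    using y_pos by (simp add: det2_frame frame_vel_0 frame_0 P_def Q_def field_simps)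
qed

lemma support_1:
  "((x\<^sup>2 + y\<^sup>2) * (sqrt 3 / 2) - x / 2) * (Q j t - sqrt 3 / 2) \<le> (1/2 - x * (sqrt 3 / 2)) * (1/2 - P j t)"
proof -
  have "y * det2 (vel 1 a) (\<sigma> 1 a) \<le> y * det2 (vel 1 a) (\<sigma> j t)"
    using y_pos by (intro mult_left_mono support[OF curve_in_K]) simp
  then have "(x / 2 - (x\<^sup>2 + y\<^sup>2) * (sqrt 3 / 2)) * (sqrt 3 / 2) - (1/2 - x * (sqrt 3 / 2)) * (1/2)
    \<le> (x / 2 - (x\<^sup>2 + y\<^sup>2) * (sqrt 3 / 2)) * Q j t - (1/2 - x * (sqrt 3 / 2)) * P j t"
    unfolding det2_frame_divide[OF frame_vel_1] by (simp add: frame_1 P_def Q_def)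
  then show ?thesis by argo
qed

lemma support_2:
  "((x\<^sup>2 + y\<^sup>2) * (sqrt 3 / 2) + x / 2) * (Q j t - sqrt 3 / 2) \<le> (1/2 + x * (sqrt 3 / 2)) * (P j t + 1/2)"
proof -
  have vel: "B *v vel 2 a = vector [(- x / 2 - (x\<^sup>2 + y\<^sup>2) * (sqrt 3 / 2)) / y, (- 1/2 - x * (sqrt 3 / 2)) / y]"
  proof -
    have "(x / 2 - c) / y - x / y = (- x / 2 - c) / y" "(1/2 - c) / y - 1 / y = (- 1/2 - c) / y" for c
      using y_pos by (simp_all add: field_simps)
    then show ?thesis
      by (simp add: vel_2 matrix_vector_mult_diff_distrib frame_vel_0 frame_vel_1 vec_eq_iff forall_2)
  qed
  have "B *v \<sigma> 2 a = vector [- 1/2, sqrt 3 / 2]"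
    using PQ_start(5,6) by (simp add: vec_eq_iff forall_2 P_def Q_def)
  moreover have "y * det2 (vel 2 a) (\<sigma> 2 a) \<le> y * det2 (vel 2 a) (\<sigma> j t)"
    using y_pos by (intro mult_left_mono support[OF curve_in_K]) simp
  ultimately have "(- x / 2 - (x\<^sup>2 + y\<^sup>2) * (sqrt 3 / 2)) * (sqrt 3 / 2) - (- 1/2 - x * (sqrt 3 / 2)) * (- 1/2)
    \<le> (- x / 2 - (x\<^sup>2 + y\<^sup>2) * (sqrt 3 / 2)) * Q j t - (- 1/2 - x * (sqrt 3 / 2)) * P j t"
    unfolding det2_frame_divide[OF vel] by (simp add: P_def Q_def)
  then show ?thesis by argo
qed

text \<open>\<open>Q j t\<close> is the determinant with \<open>\<sigma> 0 a\<close>, and \<sigma> 1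
  and \<sigma> 2 are \<sigma> 0 taken \<open>tf\<close> and \<open>2 * tf\<close> later, so
  \<open>det_pos\<close> applies. The two excluded ends are the passages through
  \<open>\<sigma> 0 a\<close> and its antipode.\<close>

lemma Q_pos: "a < t \<Longrightarrow> t \<le> a + tf \<Longrightarrow> Q 0 t > 0"
  "a \<le> t \<Longrightarrow> t \<le> a + tf \<Longrightarrow> Q 1 t > 0"
  "a \<le> t \<Longrightarrow> t < a + tf \<Longrightarrow> Q 2 t > 0"
proof -
  have "Q 1 t = Q 0 (t + tf)" "Q 2 t = Q 0 (t + 2 * tf)"
    using shift[of 0 t] shift[of 0 "t + tf"] shift[of 1 t] by (simp_all add: Q_def add.assoc)
  then show "a < t \<Longrightarrow> t \<le> a + tf \<Longrightarrow> Q 0 t > 0"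
    "a \<le> t \<Longrightarrow> t \<le> a + tf \<Longrightarrow> Q 1 t > 0"
    "a \<le> t \<Longrightarrow> t < a + tf \<Longrightarrow> Q 2 t > 0"
    using det_pos[of a t 0] det_pos[of a "t + tf" 0] det_pos[of a "t + 2 * tf" 0] tf_pos
    by (simp_all add: det2_PQ PQ_start)
qed

lemma cross_pos:
  assumes "a \<le> t" "t \<le> a + tf"
  shows "Q 2 t / 2 - sqrt 3 / 2 * P 2 t > 0"
  using det_pos[of a "t + tf" 1] tf_pos assms shift[of 1 t] by (simp add: det2_PQ PQ_start)

end

context framed_curve
begin

text \<open>The tangents at \<open>\<sigma> 1 a\<close> and \<open>\<sigma> 2 a\<close> confine \<open>\<sigma> 1\<close> to a triangle of height at most
  \<open>e = 1 / (4 h (9/2)\<^sup>2)\<close> over the edge joining these two points. The times \<open>t\<close> and \<open>t'\<close> at which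
  \<open>\<sigma> 0\<close> and \<open>\<sigma> 2\<close> are at distance \<open>s\<close> below this edge catch the two upper corners of the limiting
  parallelogram; \<open>s = 0.157\<close> nearly minimizes the loss \<open>s + 2 h e / s\<close>.\<close>

lemma area_cusp:
  assumes y: "y > 9/2" and x: "\<bar>x\<bar> < 1 / sqrt 3"
  shows "measure lebesgue K > 3.15"
proof -
  define h where "h = sqrt 3 / 2"
  have hh: "h * h = 3/4" by (simp add: h_def)
  have h0: "h > 0" by (simp add: h_def)
  have h: "h > 0.866" "h < 0.867"
    using real_less_rsqrt[of "1.732" 3] real_less_lsqrt[of "1.734" 3]
    by (simp_all add: h_def power2_eq_square)
  have xh: "\<bar>x\<bar> * h < 1/2"
  proof -
    have "\<bar>x\<bar> * h < 1 / sqrt 3 * h" using x h0 by (rule mult_strict_right_mono)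
    then show ?thesis by (simp add: h_def)
  qed
  have m: "1/2 - x * h > 0" "1/2 + x * h > 0"
  proof -
    have "\<bar>x * h\<bar> < 1/2" using xh h0 by (simp add: abs_mult)
    then show "1/2 - x * h > 0" "1/2 + x * h > 0" by linarith+
  qed
  define e where "e = 1 / (81 * h)"
  have e0: "e > 0" using h0 by (simp add: e_def)
  have low: "Q 1 t - h \<le> e" for t
  proof -
    let ?q = "Q 1 t - h"
    \<comment> \<open>These weights make \<open>P 1 t\<close> and the mixed terms in
      \<open>x\<close> cancel: the sum bounds the height of the apex of the triangle.\<close>
    have "(1/2 + x * h) * (((x\<^sup>2 + y\<^sup>2) * h - x / 2) * ?q) \<le> (1/2 + x * h) * ((1/2 - x * h) * (1/2 - P 1 t))"
      using m support_1[of 1 t] by (intro mult_left_mono) (auto simp: h_def)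
    moreover have "(1/2 - x * h) * (((x\<^sup>2 + y\<^sup>2) * h + x / 2) * ?q) \<le> (1/2 - x * h) * ((1/2 + x * h) * (P 1 t + 1/2))"
      using m support_2[of 1 t] by (intro mult_left_mono) (auto simp: h_def)
    ultimately have "(1/2 + x * h) * (((x\<^sup>2 + y\<^sup>2) * h - x / 2) * ?q) + (1/2 - x * h) * (((x\<^sup>2 + y\<^sup>2) * h + x / 2) * ?q)
      \<le> (1/2 + x * h) * ((1/2 - x * h) * (1/2 - P 1 t)) + (1/2 - x * h) * ((1/2 + x * h) * (P 1 t + 1/2))"
      by (rule add_mono)
    also have "\<dots> = 1/4 - x\<^sup>2 * (h * h)" by (simp add: field_simps power2_eq_square)
    also have "(1/2 + x * h) * (((x\<^sup>2 + y\<^sup>2) * h - x / 2) * ?q) + (1/2 - x * h) * (((x\<^sup>2 + y\<^sup>2) * h + x / 2) * ?q)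
      = y\<^sup>2 * h * ?q" by (simp add: field_simps power2_eq_square)
    finally have "y\<^sup>2 * h * ?q \<le> 1/4 - x\<^sup>2 * (h * h)" .
    moreover have "0 \<le> x\<^sup>2 * (h * h)" using hh by simp
    ultimately have q: "y\<^sup>2 * h * ?q \<le> 1/4" by linarith
    show ?thesis
    proof (cases "?q \<le> 0")
      case True
      then show ?thesis using e0 by linarith
    next
      case False
      have "(9/2)\<^sup>2 \<le> y\<^sup>2" using y by (intro power_mono) auto
      then have "(81/4) * (h * ?q) \<le> y\<^sup>2 * (h * ?q)"
        using False h0 by (intro mult_right_mono) (auto simp: power2_eq_square)
      moreover have "y\<^sup>2 * (h * ?q) \<le> 1/4" using q by (simp only: mult.assoc)
      moreover have "?q * (81 * h) = 4 * ((81/4) * (h * ?q))" by simp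
      ultimately have "?q * (81 * h) \<le> 1" by linarith
      then show ?thesis using h0 by (simp add: e_def field_simps)
    qed
  qed
  define s :: real where "s = 0.157"
  have s: "s > 0" "s < h" using h by (auto simp: s_def)
  have frac: "s / (s + e) \<le> s / (s + d)" if "d \<le> e" "s + d > 0" for d
    using that s e0 by (intro divide_left_mono) auto
  have "\<exists>t\<ge>a. t \<le> a + tf \<and> Q 0 t = h - s"
    using PQ_start PQ_end(2)[of 0] tf_pos s continuous_on_PQ(2)[of "{a..a+tf}" 0]
    by (intro IVT') (auto simp: h_def)
  then obtain t where t: "a \<le> t" "t \<le> a + tf" "Q 0 t = h - s" by auto
  have "\<exists>t\<ge>a. t \<le> a + tf \<and> Q 2 t = h - s"
    using PQ_start PQ_end(2)[of 2] tf_pos s continuous_on_PQ(2)[of "{a..a+tf}" 2]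
    by (intro IVT2') (auto simp: h_def)
  then obtain t' where t': "a \<le> t'" "t' \<le> a + tf" "Q 2 t' = h - s" by auto
  have right: "P 0 t \<ge> x * (h - s) + s / (s + e)"
  proof -
    define d where "d = Q 1 t - h"
    have "t \<noteq> a + tf" using t(3) PQ_end(2)[of 0] PQ_start s by (auto simp: h_def)
    then have pos: "s + d > 0" using Q_pos(3)[of t] t by (simp add: PQ_2 d_def)
    \<comment> \<open>The tangent at \<open>\<sigma> 0 a\<close> applied to
      \<open>- \<sigma> 2 t\<close> bounds \<open>P 1 t\<close> below in terms of
      \<open>P 0 t\<close>; the determinant equation then bounds \<open>P 0 t\<close>. The limiting
      side has abscissa \<open>1 + x * (h - s)\<close> at this height, so only
      \<open>e / (s + e)\<close> is lost. The mirror bound \<open>left\<close> uses \<sigma> 0 at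
      time \<open>t'\<close>.\<close>
    have "- P 2 t - 1 \<le> x * (- Q 2 t)" using support_0[of 5 t] curve_3[of 2 t]
      by (simp add: P_def Q_def matrix_vector_mult_def sum_2)
    then have "P 1 t \<ge> P 0 t - 1 + x * (s + d)" using t(3) by (simp add: PQ_2 d_def algebra_simps)
    then have "(h - s) * P 1 t \<ge> (h - s) * (P 0 t - 1 + x * (s + d))"
      using s by (intro mult_left_mono) auto
    moreover have "P 0 t * (h + d) - (h - s) * P 1 t = h"
      using PQ_det[of t] t(3) by (simp add: d_def h_def)
    ultimately have "P 0 t * (s + d) \<ge> s + x * (h - s) * (s + d)" by (simp add: algebra_simps)
    then have "P 0 t \<ge> (s + x * (h - s) * (s + d)) / (s + d)" using pos by (simp add: pos_divide_le_eq)
    also have "(s + x * (h - s) * (s + d)) / (s + d) = s / (s + d) + x * (h - s)"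
      using pos by (simp add: add_divide_distrib)
    finally show ?thesis using frac[of d] low[of t] pos by (simp add: d_def)
  qed
  have left: "- P 2 t' \<ge> - x * (h - s) + s / (s + e)"
  proof -
    define d where "d = Q 1 t' - h"
    have "t' \<noteq> a" using t'(3) PQ_start s by (auto simp: h_def)
    then have pos: "s + d > 0" using Q_pos(1)[of t'] t' by (simp add: PQ_2 d_def)
    have Q0: "Q 0 t' = s + d" using t'(3) by (simp add: PQ_2 d_def)
    have "P 0 t' - 1 \<le> x * (s + d)" using support_0[of 0 t'] Q0 by simp
    then have "(h - s) * P 0 t' \<le> (h - s) * (1 + x * (s + d))"
      using s by (intro mult_left_mono) auto
    moreover have "P 0 t' * (h + d) - (s + d) * (P 2 t' + P 0 t') = h"
      using PQ_det[of t'] Q0 by (simp add: d_def h_def PQ_2)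
    ultimately have "- P 2 t' * (s + d) \<ge> s - x * (h - s) * (s + d)" by (simp add: algebra_simps)
    then have "- P 2 t' \<ge> (s - x * (h - s) * (s + d)) / (s + d)" using pos by (simp add: pos_divide_le_eq)
    also have "(s - x * (h - s) * (s + d)) / (s + d) = s / (s + d) - x * (h - s)"
      using pos by (simp add: diff_divide_distrib)
    finally show ?thesis using frac[of d] low[of t'] pos by (simp add: d_def)
  qed
  \<comment> \<open>The middle time is \<open>a\<close> itself: the arc from
    \<open>\<sigma> 1 a\<close> to \<open>\<sigma> 2 a\<close> contributes only its chord.\<close>
  have "2 * h + P 0 t * h - h * P 2 t' - s \<le> measure lebesgue K"
    using polygon_area_bound[OF t(1,2) order_refl _ t'(1,2)] tf_pos t(3) t'(3) hh
    by (simp add: det2_PQ PQ_start flip: h_def)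
  moreover have "h * (P 0 t - P 2 t') \<ge> h * (2 * (s / (s + e)))"
    using left right h0 by (intro mult_left_mono) auto
  ultimately have "measure lebesgue K \<ge> 2 * h - s + 2 * h * (s / (s + e))"
    by (simp add: algebra_simps)
  moreover have "s / (s + e) \<ge> 0.916"
  proof -
    have "e < 0.01427" using h by (simp add: e_def field_simps)
    then show ?thesis using e0 by (simp add: s_def field_simps)
  qed
  then have "2 * h * (s / (s + e)) \<ge> 2 * h * 0.916" using h0 by (intro mult_left_mono) auto
  ultimately show ?thesis using h by (simp add: s_def)
qed

end

context framed_curve
begin

text \<open>In the basis \<open>\<sigma> 0 a\<close>, \<open>\<sigma> 1 a\<close> one has \<open>\<sigma> 1 t = (- A, D)\<close> and \<open>- \<sigma> 2 t = (E, - C)\<close>, so that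
  \<open>D E = 1 + A C\<close>. The tangents at \<open>\<sigma> 0 a\<close> and \<open>\<sigma> 1 a\<close> have slopes \<open>r q\<close> and \<open>r / q\<close>; both are at
  most \<open>0.3 h\<close> outside the horoballs. The time \<open>t\<close> is chosen so that \<open>A\<close> and \<open>q C\<close> balance.\<close>

lemma area_wall:
  assumes v: "x < 1 / sqrt 3" and wall: "y > 15 * (1 / sqrt 3 - x)" and y: "y \<le> 9/2"
    and horoball: "(x - 1 / sqrt 3)\<^sup>2 + y\<^sup>2 \<ge> 8/27 * y"
  shows "measure lebesgue K > 3.15"
proof -
  define h where "h = sqrt 3 / 2"
  define v where "v = 1 / sqrt 3 - x"
  have hh: "h * h = 3/4" by (simp add: h_def)
  have h0: "h > 0" by (simp add: h_def)
  have h: "h > 0.866" "h < 0.867"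
    using real_less_rsqrt[of "1.732" 3] real_less_lsqrt[of "1.734" 3]
    by (simp_all add: h_def power2_eq_square)
  have s3: "1 / sqrt 3 = 2 / 3 * h" by (simp add: h_def field_simps)
  have v0: "v > 0" "15 * v < y" using assms by (simp_all add: v_def)
  have xv: "x = 2 / 3 * h - v" by (simp add: v_def s3)
  \<comment> \<open>The distance from \<open>z\<close> to the cusp \<open>1 / sqrt 3\<close>;
    \<open>r = v / n\<close> is the sine of the angle which the segment to the cusp makes with the
    vertical.\<close>
  define n where "n = sqrt (v\<^sup>2 + y\<^sup>2)"
  have nn: "n\<^sup>2 = v\<^sup>2 + y\<^sup>2" by (simp add: n_def)
  have n0: "n > 0" using v0 by (simp add: n_def sum_power2_gt_zero_iff)
  define q where "q = h * n"
  define r where "r = v / n"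
  have q0: "q > 0" and r0: "r > 0" using n0 h0 v0 by (simp_all add: q_def r_def)
  have r15: "r < 1/15"
  proof -
    have "(15 * v)\<^sup>2 < y\<^sup>2" using v0 by (intro power_strict_mono) auto
    also have "y\<^sup>2 \<le> n\<^sup>2" by (simp add: nn)
    finally have "(15 * v)\<^sup>2 < n\<^sup>2" .
    then have "15 * v < n" using n0 by (rule power2_less_imp_less[OF _ less_imp_le])
    then show ?thesis using n0 by (simp add: r_def field_simps)
  qed
  define A where "A t = Q 1 t / (2 * h) - P 1 t" for t
  define D where "D t = Q 1 t / h" for t
  define C where "C t = Q 2 t / h" for t
  define E where "E t = Q 2 t / (2 * h) - P 2 t" for t
  have PQ: "Q 1 t = h * D t" "P 1 t = D t / 2 - A t" "Q 2 t = h * C t" "P 2 t = C t / 2 - E t" for t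
    using h0 by (simp_all add: A_def D_def C_def E_def)
  have det: "D t * E t = 1 + A t * C t" for t
  proof -
    have "P 1 t * Q 2 t - Q 1 t * P 2 t = h"
      using PQ_det[of t] by (simp add: PQ_2 h_def algebra_simps)
    then have "h * (D t * E t - A t * C t) = h * 1" by (simp add: PQ algebra_simps)
    then show ?thesis using h0 by simp
  qed
  have xh: "x * h = 1/2 - h * v" using hh by (simp add: xv algebra_simps)
  then have c1: "1/2 - x * h = h * v" by simp
  have x2: "x\<^sup>2 = 1/3 - 4/3 * (h * v) + v\<^sup>2"
    using hh by (simp add: xv power2_eq_square algebra_simps)
  have "q * q = (h * h) * n\<^sup>2" by (simp add: q_def power2_eq_square)
  \<comment> \<open>Both sides are the squared modulus of \<open>h * z - 1/2\<close>, since
    \<open>h / sqrt 3 = 1/2\<close>.\<close>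
  then have c2: "h * h * (x\<^sup>2 + y\<^sup>2) - x * h + 1/4 = q * q"
    unfolding hh nn xh x2 by argo
  have suppD: "D t - 1 \<le> r * (A t / q)" for t
  proof -
    have "((x\<^sup>2 + y\<^sup>2) * h - x / 2) * (h * D t - h) \<le> (1/2 - x * h) * (1/2 - (D t / 2 - A t))"
      using support_1[of 1 t] by (simp add: PQ flip: h_def)
    then have "(((x\<^sup>2 + y\<^sup>2) * h - x / 2) * h + (1/2 - x * h) / 2) * (D t - 1) \<le> (1/2 - x * h) * A t"
      by (simp add: field_simps)
    moreover have "((x\<^sup>2 + y\<^sup>2) * h - x / 2) * h + (1/2 - x * h) / 2 = h * h * (x\<^sup>2 + y\<^sup>2) - x * h + 1/4"
      by (simp add: field_simps)
    ultimately have "q * q * (D t - 1) \<le> h * v * A t"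
      by (simp only: c1 c2)
    then have "D t - 1 \<le> h * v * A t / (q * q)"
      using q0 by (simp add: pos_le_divide_eq mult.commute)
    also have "\<dots> = r * (A t / q)" using n0 h0 by (simp add: q_def r_def)
    finally show ?thesis .
  qed
  have suppE: "E t - 1 \<le> r * q * C t" for t
  proof -
    have "P 5 t = - P 2 t" "Q 5 t = - Q 2 t"
      using curve_3[of 2 t] by (simp_all add: P_def Q_def matrix_vector_mult_def sum_2)
    then have "- P 2 t - 1 \<le> x * (- Q 2 t)" using support_0[of 5 t] by simp
    then have "E t - 1 \<le> (1/2 - x * h) * C t" by (simp add: PQ algebra_simps)
    also have "1/2 - x * h = r * q"
      using hh n0 by (simp add: xv r_def q_def algebra_simps)
    finally show ?thesis .
  qed
  have "\<exists>t\<ge>a. t \<le> a + tf \<and> A t - q * C t = 0"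
  proof (rule IVT')
    have "1 / h = 4 / 3 * h" using hh h0 by (simp add: field_simps)
    then show "A a - q * C a \<le> 0" "0 \<le> A (a + tf) - q * C (a + tf)"
      using q0 h0 by (simp_all add: A_def C_def PQ_start PQ_end flip: h_def)
    show "a \<le> a + tf" using tf_pos by simp
    show "continuous_on {a..a + tf} (\<lambda>t. A t - q * C t)"
      unfolding A_def C_def using h0 by (intro continuous_intros continuous_on_PQ) auto
  qed
  then obtain t where t: "a \<le> t" "t \<le> a + tf" "A t = q * C t" by auto
  define c where "c = C t"
  have D: "D t \<le> 1 + r * c" using suppD[of t] t(3) q0 by (simp add: c_def)
  have E: "E t \<le> 1 + r * q * c" using suppE[of t] by (simp add: c_def)
  have DE: "D t * E t = 1 + q * c\<^sup>2" using det[of t] t(3) by (simp add: c_def power2_eq_square)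
  have D0: "D t > 0" using Q_pos(2)[OF t(1,2)] h0 by (simp add: D_def)
  have E0: "E t > 0" using cross_pos[OF t(1,2)] h0 by (simp add: E_def h_def field_simps)
  have area: "h * (2 * D t + 2 * E t - (1 + q) * c) \<le> measure lebesgue K"
  proof -
    have P0: "P 0 t = P 1 t - P 2 t" "Q 0 t = Q 1 t - Q 2 t" by (simp_all add: PQ_2)
    show ?thesis
      using polygon_area_bound[OF t(1,2) t(1,2) t(1,2)] t(3)
      by (simp add: det2_PQ PQ_start P0 flip: h_def) (simp add: PQ c_def field_simps)
  qed
  \<comment> \<open>Here \<open>k\<^sup>2 = A t * C t\<close> and \<open>k * W = A t + C t\<close>;
    \<open>W\<close> is unchanged under replacing \<open>q\<close> by \<open>1 / q\<close>, which
    exchanges the two slopes.\<close>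
  define k where "k = sqrt q * c"
  define W where "W = (1 + q) / sqrt q"
  have kk: "k\<^sup>2 = q * c\<^sup>2" using q0 by (simp add: k_def power_mult_distrib)
  have kW: "k * W = (1 + q) * c" using q0 by (simp add: k_def W_def)
  \<comment> \<open>The mean inequality gives at least \<open>2 * sqrt (1 + k\<^sup>2)\<close>, and
    the right side is its Taylor polynomial in \<open>k\<^sup>2\<close>. For
    \<open>k\<^sup>2 > 2\<close> the maximum 3 of that polynomial is enough.\<close>
  have DE2: "D t + E t \<ge> 2 + k\<^sup>2 - k ^ 4 / 4"
  proof (cases "k\<^sup>2 \<le> 2")
    case True
    have "(2 + u - u ^ 2 / 4)\<^sup>2 = 4 * (1 + u) - u ^ 3 * (8 - u) / 16" for u :: real
      by (simp add: power2_eq_square power3_eq_cube field_simps)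
    from this[of "k\<^sup>2"]
    have "(2 + k\<^sup>2 - k ^ 4 / 4)\<^sup>2 = 4 * (1 + k\<^sup>2) - (k\<^sup>2) ^ 3 * (8 - k\<^sup>2) / 16"
      by (simp flip: power_mult)
    also have "\<dots> \<le> 4 * (1 + k\<^sup>2)" using True by simp
    also have "\<dots> = 4 * (D t * E t)" by (simp add: DE kk)
    also have "\<dots> \<le> (D t + E t)\<^sup>2" using zero_le_power2[of "D t - E t"]
      by (simp add: power2_eq_square algebra_simps)
    finally show ?thesis by (rule power2_le_imp_le) (use D0 E0 in simp)
  next
    case False
    have "0 \<le> (k\<^sup>2 - 2)\<^sup>2" by simp
    have "4 * (1 + k\<^sup>2) = 4 * (D t * E t)" by (simp add: DE kk)
    also have "\<dots> \<le> (D t + E t)\<^sup>2" using zero_le_power2[of "D t - E t"]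
      by (simp add: power2_eq_square algebra_simps)
    finally have "3\<^sup>2 \<le> (D t + E t)\<^sup>2" using False by simp
    then have "D t + E t \<ge> 3" by (rule power2_le_imp_le) (use D0 E0 in simp)
    moreover have "2 + k\<^sup>2 - k ^ 4 / 4 \<le> 3"
      using \<open>0 \<le> (k\<^sup>2 - 2)\<^sup>2\<close> by (simp add: power2_eq_square eval_nat_numeral algebra_simps)
    ultimately show ?thesis by linarith
  qed
  \<comment> \<open>The parallelogram would give 4, and \<open>0.866 * 1819/500\<close> still
    exceeds \<open>3.15\<close>. By \<open>DE2\<close> it remains to keep the loss
    \<open>k * W - 2 * k\<^sup>2 + k ^ 4 / 2\<close> below \<open>181/500\<close>.\<close>
  have "2 * D t + 2 * E t - (1 + q) * c > (1819/500)"
  proof (cases "c \<le> 0")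
    case True
    have "2\<^sup>2 \<le> 4 * (1 + q * c\<^sup>2)" using q0 by simp
    also have "\<dots> \<le> (D t + E t)\<^sup>2" using zero_le_power2[of "D t - E t"] DE
      by (simp add: power2_eq_square algebra_simps)
    finally have "D t + E t \<ge> 2" by (rule power2_le_imp_le) (use D0 E0 in simp)
    moreover have "(1 + q) * c \<le> 0" using True q0 by (simp add: mult_nonneg_nonpos)
    ultimately show ?thesis by linarith
  next
    case False
    then have c0: "c > 0" by simp
    have k0: "k > 0" using c0 q0 by (simp add: k_def)
    have W0: "W > 0" using q0 by (simp add: W_def)
    have W2: "W\<^sup>2 = q + 2 + 1 / q" using q0 by (simp add: W_def power_divide field_simps power2_eq_square)
    have "0 \<le> (sqrt q - 1)\<^sup>2" by simp
    then have "2 * sqrt q \<le> 1 + q" using q0 by (simp add: power2_diff)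
    then have Wge: "W \<ge> 2" using q0 by (simp add: W_def field_simps)
    \<comment> \<open>The product \<open>D t * E t\<close> is known exactly, while the tangents
      bound its factors above; comparing the two bounds \<open>c\<close>.\<close>
    have "(1 + q * c\<^sup>2) \<le> (1 + r * c) * (1 + r * q * c)"
      unfolding DE[symmetric] using D E D0 E0 r0 c0 by (intro mult_mono) auto
    then have "c * (q * c * (1 - r\<^sup>2)) \<le> c * (r * (1 + q))"
      by (simp add: power2_eq_square algebra_simps)
    then have "q * c * (1 - r\<^sup>2) \<le> r * (1 + q)" using c0 by simp
    moreover have "q * c = sqrt q * k" "1 + q = sqrt q * W"
      using q0 by (simp_all add: k_def W_def)
    ultimately have "sqrt q * (k * (1 - r\<^sup>2)) \<le> sqrt q * (r * W)"
      by (simp only: mult.assoc mult.left_commute[of r])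
    then have kr: "k * (1 - r\<^sup>2) \<le> r * W" using q0 by simp
    have rr: "r\<^sup>2 \<le> r / 15" using r15 r0 by (simp add: power2_eq_square)
    then have "r\<^sup>2 \<le> 1/225" using r15 by simp
    then have "k * (224/225) \<le> r * W" using kr k0 mult_left_mono[of "224/225" "1 - r\<^sup>2" k] by linarith
    \<comment> \<open>\<open>201/200\<close> rounds up \<open>225/224\<close>, the inverse of the
      lower bound for \<open>1 - r\<^sup>2\<close>.\<close>
    define m where "m = (201/200) * r * W"
    have km: "k \<le> m" 
      using \<open>k * (224/225) \<le> r * W\<close> mult_pos_pos[OF r0 W0] unfolding m_def mult.assoc by linarith
    define T where "T = r * W\<^sup>2"
    have T: "T = r * q + r / q + 2 * r" using q0 by (simp add: T_def W2 algebra_simps)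
    have rq: "r * q = h * v" using n0 by (simp add: r_def q_def)
    have rdq: "r / q = v / (h * n\<^sup>2)" by (simp add: r_def q_def power2_eq_square)
    \<comment> \<open>The horoball at \<open>1 / sqrt 3\<close> bounds the slope
      \<open>r / q\<close>, and the one at infinity bounds \<open>r * q\<close>; the constants
      agree.\<close>
    have "8/27 * y \<le> n\<^sup>2" using horoball by (simp add: nn v_def power2_commute[of x])
    then have "v * (8 / 27 * 15) \<le> n\<^sup>2 * 1" using v0 by linarith
    then have "v / n\<^sup>2 \<le> 27/120" using n0 by (simp add: field_simps)
    then have "v / n\<^sup>2 / h \<le> 27/120 / h" using h0 by (intro divide_right_mono) auto
    moreover have "27/120 / h = (3/10) * h" using hh h0 by (simp add: field_simps)
    ultimately have M2: "r / q \<le> (3/10) * h" by (simp add: rdq mult.commute)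
    have M1: "r * q \<le> (3/10) * h" using v0 y h0 by (simp add: rq)
    \<comment> \<open>Two numbers of product \<open>r\<^sup>2\<close>, each at most
      \<open>0.3 * h\<close>, have sum at most
      \<open>0.3 * h + r\<^sup>2 / (0.3 * h)\<close>.\<close>
    have "0 \<le> ((3/10) * h - r * q) * ((3/10) * h - r / q)" using M1 M2 by simp
    also have "\<dots> = (9/100) * (h * h) - (3/10) * h * (r * q + r / q) + r\<^sup>2"
      using q0 by (simp add: algebra_simps power2_eq_square)
    finally have "(3/10) * h * (r * q + r / q) \<le> (27/400) + r\<^sup>2" unfolding hh by argo
    moreover have "(1299/5000) * (r * q + r / q) \<le> (3/10) * h * (r * q + r / q)"
      using h r0 q0 by (intro mult_right_mono) auto
    ultimately have Tr: "T \<le> (13/50) + (77/20) * r\<^sup>2 + 2 * r" unfolding T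
      using zero_le_power2[of r] by argo
    have T0: "T > 0" using r0 W0 by (simp add: T_def)
    have T1: "T \<le> (411/1000)" using Tr \<open>r\<^sup>2 \<le> 1/225\<close> r15 by simp
    have mm: "m\<^sup>2 = (40401/40000) * (r * T)" by (simp add: m_def T_def power2_eq_square)
    have mW: "m * W = (201/200) * T" by (simp add: m_def T_def power2_eq_square)
    have rT: "r * T \<le> 1/15 * (411/1000)" using r15 T1 r0 T0 by (intro mult_mono) auto
    have m0: "m > 0" using r0 W0 by (simp add: m_def)
    have "m\<^sup>2 \<le> (139/5000)" using rT unfolding mm by linarith
    then have m4: "m ^ 4 \<le> (139/5000)\<^sup>2"
      using power_mono[of "m\<^sup>2" "(139/5000)" 2] by (simp flip: power_mult)
    have "m\<^sup>2 \<le> (1/2)\<^sup>2" using \<open>m\<^sup>2 \<le> (139/5000)\<close> by (simp add: power2_eq_square)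
    then have "m \<le> 1/2" by (rule power2_le_imp_le) simp
    \<comment> \<open>The part \<open>k * W - 2 * k\<^sup>2\<close> of the loss increases in
      \<open>k\<close> up to \<open>W / 4\<close>, which is at least 1/2, so \<open>k\<close> may be
      replaced by its bound \<open>m\<close>.\<close>
    have "0 \<le> (m - k) * (W - 2 * (m + k))" using km \<open>m \<le> 1/2\<close> Wge by simp
    then have "k * W - 2 * k\<^sup>2 \<le> m * W - 2 * m\<^sup>2" by (simp add: algebra_simps power2_eq_square)
    moreover have "k ^ 4 \<le> m ^ 4" using km k0 by (intro power_mono) auto
    moreover have "T * ((201/200) - (40401/20000) * r) = m * W - 2 * m\<^sup>2"
      unfolding mW mm by (simp add: algebra_simps)
    ultimately have F: "k * W - 2 * k\<^sup>2 + k ^ 4 / 2 \<le> T * ((201/200) - (40401/20000) * r) + (139/5000)\<^sup>2 / 2"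
      using m4 by linarith
    have "T * ((201/200) - (40401/20000) * r) \<le> ((13/50) + (77/20) * r\<^sup>2 + 2 * r) * ((201/200) - (40401/20000) * r)"
      using Tr r15 by (intro mult_right_mono) auto
    also have "\<dots> = (2613/10000) + (1484787/1000000) * r - (3417/20000) * r\<^sup>2 - (3110877/400000) * (r\<^sup>2 * r)"
      by (simp add: field_simps power2_eq_square)
    also have "\<dots> \<le> (2613/10000) + (1484787/1000000) * r"
      using mult_nonneg_nonneg[OF zero_le_power2[of r] less_imp_le[OF r0]] zero_le_power2[of r] by linarith
    finally have "k * W - 2 * k\<^sup>2 + k ^ 4 / 2 < (181/500)" using F r15 by (simp add: power2_eq_square)
    then show ?thesis using DE2 kW by linarith
  qed
  then have "h * (1819/500) \<le> h * (2 * D t + 2 * E t - (1 + q) * c)" using h0 by (intro mult_left_mono) auto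
  moreover have "3.15 < h * (1819/500)" using h by simp
  ultimately show ?thesis using area by (meson less_le_trans)
qed

end

section \<open>The unit disk and the smoothed octagon\<close>

lemma sin_cubic_bounds:
  fixes x :: real
  assumes "x \<ge> 0"
  shows "sin x \<ge> x - x ^ 3 / 6 - x ^ 5 / 120" "sin x \<le> x - x ^ 3 / 6 + x ^ 5 / 120"
proof -
  have "{..<5::nat} = {0, 1, 2, 3, 4}" by auto
  then have sum: "(\<Sum>i<5. sin_coeff i * x ^ i) = x - x ^ 3 / 6"
    by (simp add: sin_coeff_def fact_numeral)
  have "\<bar>sin x - (x - x ^ 3 / 6)\<bar> \<le> inverse (fact 5) * \<bar>x\<bar> ^ 5"
    using Maclaurin_sin_bound[of x 5] unfolding sum .
  also have "\<dots> = x ^ 5 / 120" using assms by (simp add: fact_numeral)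
  finally have "\<bar>sin x - (x - x ^ 3 / 6)\<bar> \<le> x ^ 5 / 120" .
  then show "sin x \<ge> x - x ^ 3 / 6 - x ^ 5 / 120" "sin x \<le> x - x ^ 3 / 6 + x ^ 5 / 120"
    by linarith+
qed

text \<open>Since \<open>sin (pi / 6) = 1/2\<close>, it suffices to compare the Taylor bound at
  \<open>3.15 / 6\<close> with 1/2; \<open>pi_greater\<close> does the same at
  \<open>3.13 / 6\<close>.\<close>

lemma pi_less: "pi < 3.15"
proof (rule ccontr)
  assume "\<not> pi < 3.15"
  then have p: "0.525 \<le> pi / 6" by simp
  have "sin (0.525::real) > 1/2"
    using sin_cubic_bounds(1)[of "0.525"] by (simp add: power3_eq_cube power_divide eval_nat_numeral)
  moreover have "sin (0.525::real) \<le> sin (pi / 6)"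
    using p pi_gt_zero by (intro sin_monotone_2pi_le) (simp_all add: field_simps)
  ultimately show False by (simp add: sin_30)
qed

lemma pi_greater: "pi > 3.13"
proof (rule ccontr)
  let ?x = "3.13 / 6 :: real"
  assume "\<not> pi > 3.13"
  then have p: "pi / 6 \<le> ?x" by simp
  have "sin ?x < 1/2"
    using sin_cubic_bounds(2)[of ?x] by (simp add: power3_eq_cube power_divide eval_nat_numeral)
  moreover have "sin (pi / 6) \<le> sin ?x"
    using p pi_gt3 by (intro sin_monotone_2pi_le) (simp_all add: field_simps)
  ultimately show False by (simp add: sin_30)
qed

lemma smoothed_octagon_area_less_pi: "smoothed_octagon_area < pi"
proof -
  have s2: "sqrt 2 > 1.41421" "sqrt 2 < 1.41422"
    using real_less_rsqrt[of "1.41421" 2] real_less_lsqrt[of "1.41422" 2] by (simp_all add: power2_eq_square)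
  have s3: "sqrt 3 < 1.73206" using real_less_lsqrt[of "1.73206" 3] by (simp add: power2_eq_square)
  have s: "sqrt 12 = 2 * sqrt 3" "sqrt 32 = 4 * sqrt 2" "sqrt 8 = 2 * sqrt 2"
    using real_sqrt_mult[of 4 3] real_sqrt_mult[of 16 2] real_sqrt_mult[of 4 2] by simp_all
  \<comment> \<open>Two terms of \<open>ln 2 = 2 * artanh (1/3)\<close>, namely
    \<open>2 * (1/3 + 1/81)\<close>.\<close>
  have l: "ln 2 \<ge> (56/81::real)"
    using ln_approx_bounds[of 2 2, simplified, simplified eval_nat_numeral, simplified] by simp
  have "smoothed_octagon_area = 2 * sqrt 3 * (8 - 4 * sqrt 2 - ln 2) / (2 * sqrt 2 - 1)"
    by (simp add: smoothed_octagon_area_def s)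
  also have "\<dots> < 3.13"
  proof -
    have "2 * sqrt 3 * (8 - 4 * sqrt 2 - ln 2) \<le> 2 * sqrt 3 * (8 - 4 * 1.41421 - 56/81)"
      using s2 l by (intro mult_left_mono) auto
    also have "\<dots> < 3.13 * (2 * 1.41421 - 1)" using s3 by simp
    also have "\<dots> \<le> 3.13 * (2 * sqrt 2 - 1)" using s2 by simp
    finally show ?thesis using s2 by (simp add: pos_divide_less_eq)
  qed
  finally show ?thesis using pi_greater by linarith
qed


section \<open>The unit disk as a balanced disk\<close>

definition circle_point :: "real \<Rightarrow> real^2" where
  "circle_point \<theta> = vector [cos \<theta>, sin \<theta>]"

lemma circle_point_nth [simp]: "circle_point \<theta> $ 1 = cos \<theta>" "circle_point \<theta> $ 2 = sin \<theta>"
  by (simp_all add: circle_point_def)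

lemma det2_circle_point: "det2 (circle_point \<alpha>) (circle_point \<beta>) = sin (\<beta> - \<alpha>)"
  by (simp add: det2_eq sin_diff algebra_simps)

lemma s_star_eq: "s_star j = circle_point (pi * of_int j / 3)"
  by (simp add: s_star_def circle_point_def)

lemma norm_circle_point [simp]: "norm (circle_point \<theta>) = 1"
  by (simp add: norm_vec_def L2_set_def sum_2)

lemma has_vector_derivative_circle_point:
  "(circle_point has_vector_derivative circle_point (\<theta> + pi / 2)) (at \<theta>)"
proof -
  have "circle_point = (\<lambda>\<theta>. cos \<theta> *\<^sub>R axis 1 1 + sin \<theta> *\<^sub>R axis 2 1)"
    by (simp add: fun_eq_iff vec_eq_iff forall_2 axis_def)
  moreover have "((\<lambda>\<theta>. cos \<theta> *\<^sub>R axis 1 1 + sin \<theta> *\<^sub>R axis 2 1) has_vector_derivative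
    (- sin \<theta>) *\<^sub>R axis 1 1 + cos \<theta> *\<^sub>R (axis 2 1 :: real^2)) (at \<theta>)"
    by (auto intro!: derivative_eq_intros)
  moreover have "(- sin \<theta>) *\<^sub>R axis 1 1 + cos \<theta> *\<^sub>R (axis 2 1 :: real^2) = circle_point (\<theta> + pi / 2)"
    by (simp add: vec_eq_iff forall_2 axis_def cos_add sin_add)
  ultimately show ?thesis by simp
qed

lemma has_vector_derivative_circle_point_shift:
  "((\<lambda>t. circle_point (t + c)) has_vector_derivative circle_point (t + (c + pi / 2))) (at t)"
proof -
  have "((\<lambda>t. t + c) has_vector_derivative 1) (at t)"
    by (auto intro!: derivative_eq_intros)
  from vector_diff_chain_at[OF this has_vector_derivative_circle_point]
  show ?thesis by (simp add: o_def add.assoc)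
qed

lemma circle_point_add_pi: "circle_point (\<theta> + pi) = - circle_point \<theta>"
  by (simp add: vec_eq_iff forall_2)

lemma circle_point_eqD:
  assumes "circle_point \<alpha> = circle_point \<beta>"
  shows "\<exists>n::int. \<alpha> = \<beta> + 2 * pi * n"
  using assms sin_cos_eq_iff[of \<alpha> \<beta>] by (auto simp: vec_eq_iff forall_2)

lemma lipschitz_circle_point: "1-lipschitz_on UNIV (\<lambda>t. circle_point (t + c))"
proof (rule bounded_derivative_imp_lipschitz)
  show "((\<lambda>t. circle_point (t + c)) has_derivative (\<lambda>h. h *\<^sub>R circle_point (t + (c + pi / 2)))) (at t within UNIV)" for t
    using has_vector_derivative_circle_point_shift by (simp add: has_vector_derivative_def)
  show "onorm (\<lambda>h. h *\<^sub>R circle_point (t + (c + pi / 2))) \<le> 1" for t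
    by (rule onorm_bound) auto
qed auto

lemma multi_point_circle: "multi_point (\<lambda>j. circle_point (t + pi * of_int j / 3))"
proof -
  let ?s = "\<lambda>j::int. circle_point (t + pi * of_int j / 3)"
  have s3: "?s (j + 3) = - ?s j" for j
  proof -
    have "t + pi * of_int (j + 3) / 3 = t + pi * of_int j / 3 + pi" by (simp add: field_simps)
    then show ?thesis by (metis circle_point_add_pi)
  qed
  have s6: "?s (j + 6) = ?s j" for j
  proof -
    have "t + pi * of_int (j + 6) / 3 = t + pi * of_int j / 3 + pi + pi" by (simp add: field_simps)
    then show ?thesis by (metis circle_point_add_pi minus_minus)
  qed
  have "?s 4 = - ?s 1" using s3[of 1] by simp
  moreover have "?s 2 = ?s 1 - ?s 0"
  proof -
    have "cos (pi * 2 / 3) = - 1 / 2" "sin (pi * 2 / 3) = sqrt 3 / 2"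
      using cos_120 sin_120 by (simp_all add: mult.commute)
    then show ?thesis
      by (simp add: vec_eq_iff forall_2 cos_add sin_add cos_60 sin_60)
  qed
  moreover have "det2 (?s j) (?s (j + 1)) = sqrt 3 / 2" for j
  proof -
    have "(t + pi * of_int (j + 1) / 3) - (t + pi * of_int j / 3) = pi / 3" by (simp add: field_simps)
    then show ?thesis by (simp only: det2_circle_point sin_60)
  qed
  ultimately show ?thesis unfolding multi_point_def using s3 s6 by simp
qed

lemma unit_disk_balanced_param:
  "balanced_param (cball 0 1) (\<lambda>j t. circle_point (t + pi * of_int j / 3)) (pi / 3)"
proof -
  have vd: "vector_derivative (\<lambda>t. circle_point (t + pi * of_int j / 3)) (at t)
    = circle_point (t + (pi * of_int j / 3 + pi / 2))" for j t
    by (rule vector_derivative_at[OF has_vector_derivative_circle_point_shift])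
  have cont: "continuous_on UNIV (\<lambda>t. circle_point (t + c))" for c
    using has_vector_derivative_circle_point_shift
    by (meson continuous_at_imp_continuous_on has_vector_derivative_continuous)
  have diff: "(\<lambda>t. circle_point (t + c)) differentiable (at t)" for c t
    using has_vector_derivative_circle_point_shift differentiableI_vector by blast
  have "(\<lambda>t. circle_point (t + pi * of_int j / 3)) C1_differentiable_on UNIV" for j
    unfolding C1_differentiable_on_eq vd using diff cont by simp
  moreover have "circle_point \<theta> \<noteq> 0" for \<theta>
    using norm_circle_point[of \<theta>] by (metis norm_zero zero_neq_one)
  moreover have "\<exists>w. ((\<lambda>t. circle_point (t + (pi * of_int j / 3 + pi / 2))) has_vector_derivative w) (at t)
      \<and> det2 (circle_point (t + (pi * of_int j / 3 + pi / 2))) w \<ge> 0" for j t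
    by (intro exI[of _ "circle_point (t + (pi * of_int j / 3 + pi / 2 + pi / 2))"] conjI
        has_vector_derivative_circle_point_shift) (simp add: det2_circle_point)
  moreover have "circle_point (t + pi * of_int j / 3) + circle_point (t + (pi * of_int j / 3 + pi / 2))
      \<in> open_cone (circle_point (t + pi * of_int j / 3)) (circle_point (t + pi * of_int (j + 1) / 3))
        (circle_point (t + pi * of_int j / 3) + circle_point (t + pi * of_int (j + 1) / 3))" for j t
  proof -
    define \<theta> where "\<theta> = t + pi * of_int j / 3"
    have e: "t + pi * of_int (j + 1) / 3 = \<theta> + pi / 3" "t + (pi * of_int j / 3 + pi / 2) = \<theta> + pi / 2"
      by (simp_all add: \<theta>_def field_simps)
    \<comment> \<open>In complex notation:
      \<open>2 * exp (\<i> * pi / 3) - 1 = \<i> * sqrt 3\<close>.\<close>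
    have "circle_point (\<theta> + pi / 2) = (1 / sqrt 3) *\<^sub>R (circle_point (\<theta> + pi / 3) - circle_point \<theta>)
      + (1 / sqrt 3) *\<^sub>R (circle_point \<theta> + circle_point (\<theta> + pi / 3) - circle_point \<theta>)"
      by (simp add: vec_eq_iff forall_2 cos_add sin_add cos_60 sin_60) (simp add: field_simps)
    then show ?thesis unfolding e \<theta>_def[symmetric] open_cone_def
      by (intro CollectI exI[of _ "1 / sqrt 3"]) (simp add: add.assoc)
  qed
  moreover have "inj_on (\<lambda>t. circle_point (t + c)) {0..<2 * pi}" for c
  proof (rule inj_onI)
    fix x y :: real
    assume xy: "x \<in> {0..<2 * pi}" "y \<in> {0..<2 * pi}" "circle_point (x + c) = circle_point (y + c)"
    then obtain n :: int where n: "x = y + 2 * pi * n" using circle_point_eqD by force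
    have "0 \<le> x" "x < 2 * pi" "0 \<le> y" "y < 2 * pi" using xy by auto
    then have "2 * pi * n < 2 * pi * 1" "2 * pi * (- 1) < 2 * pi * n" using n by linarith+
    then have "real_of_int n < 1" "- 1 < real_of_int n"
      using mult_less_cancel_left_pos[of "2 * pi"] pi_gt_zero by (metis mult_pos_pos zero_less_numeral)+
    then have "n = 0" by simp
    then show "x = y" using n by simp
  qed
  moreover have "range (\<lambda>t. circle_point (t + c)) = frontier (cball 0 1)" for c
  proof
    show "range (\<lambda>t. circle_point (t + c)) \<subseteq> frontier (cball 0 1)" by auto
    show "frontier (cball 0 1) \<subseteq> range (\<lambda>t. circle_point (t + c))"
    proof
      fix p :: "real^2" assume "p \<in> frontier (cball 0 1)"
      then have "(p $ 1)\<^sup>2 + (p $ 2)\<^sup>2 = 1"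
        by (simp add: norm_vec_def L2_set_def sum_2)
      then obtain t where "p $ 1 = cos t" "p $ 2 = sin t" by (rule sincos_total_2pi)
      then have "p = circle_point ((t - c) + c)" by (simp add: vec_eq_iff forall_2)
      then show "p \<in> range (\<lambda>t. circle_point (t + c))" by blast
    qed
  qed
  moreover have "circle_point (t + 2 * pi + c) = circle_point (t + c)" for t c
  proof -
    have "t + 2 * pi + c = (t + c) + 2 * pi" by simp
    then show ?thesis by (simp only: vec_eq_iff forall_2 circle_point_nth sin_periodic cos_periodic)
  qed
  ultimately show ?thesis
    unfolding balanced_param_def Let_def vd
    using multi_point_circle
    by (auto simp: det2_circle_point intro: exI[of _ 1] lipschitz_circle_point)
qed

lemma unit_disk_balanced: "balanced_disk (cball 0 1)"
proof -
  have "uminus ` cball (0::real^2) 1 = cball 0 1"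
  proof
    show "cball 0 1 \<subseteq> uminus ` cball (0::real^2) 1"
      by (rule subsetI, rule_tac x = "- x" in image_eqI) auto
  qed auto
  then show ?thesis
    unfolding balanced_disk_def using unit_disk_balanced_param by auto
qed

lemma area_unit_disk: "area (cball 0 1) = pi"
  by (simp add: area_def content_cball unit_ball_vol_2)

section \<open>The rotation of the upper half-plane\<close>

text \<open>For \<open>X = \<Phi> z\<close>, the value \<open>cusp_rate j z\<close> is \<open>det2 (s_star j) (X *v s_star j)\<close>, the rate at
  which \<open>\<sigma> j\<close> sweeps out twice the area. Its reciprocal is the height of \<open>z\<close> at one of the three
  cusps, and \<open>R_mat\<close> permutes the cusps.\<close>

definition cusp_rate :: "int \<Rightarrow> complex \<Rightarrow> real" where
  "cusp_rate j z = det2 (s_star j) (\<Phi> z *v s_star j)"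

lemma s_star_simps:
  "s_star 0 = vector [1, 0]" "s_star 1 = vector [1/2, sqrt 3 / 2]" "s_star 2 = vector [- 1/2, sqrt 3 / 2]"
  "s_star 3 = vector [- 1, 0]"
proof -
  have c: "cos (pi * 2 / 3) = - 1 / 2" "sin (pi * 2 / 3) = sqrt 3 / 2"
    using cos_120 sin_120 by (simp_all add: mult.commute)
  show "s_star 0 = vector [1, 0]" "s_star 1 = vector [1/2, sqrt 3 / 2]"
    "s_star 2 = vector [- 1/2, sqrt 3 / 2]" "s_star 3 = vector [- 1, 0]"
    by (simp_all add: s_star_def cos_60 sin_60 c)
qed

lemma \<Phi>_mult: "\<Phi> z *v vector [u, v] = vector [(Re z * u - ((Re z)\<^sup>2 + (Im z)\<^sup>2) * v) / Im z, (u - Re z * v) / Im z]"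
  by (simp add: \<Phi>_def vec_eq_iff forall_2 matrix_vector_mult_def sum_2 divide_inverse algebra_simps)

lemma det2_divide: "det2 (vector [a, b]) (vector [p / y, q / y]) = (a * q - b * p) / y"
  by (simp add: det2_eq diff_divide_distrib)

lemma cusp_rate_simps:
  "cusp_rate 0 z = 1 / Im z"
  "cusp_rate 1 z = 3/4 * ((Re z - 1 / sqrt 3)\<^sup>2 + (Im z)\<^sup>2) / Im z"
  "cusp_rate 2 z = 3/4 * ((Re z + 1 / sqrt 3)\<^sup>2 + (Im z)\<^sup>2) / Im z"
  "cusp_rate 3 z = cusp_rate 0 z"
proof -
  have s: "1 / sqrt 3 = sqrt 3 / 3" by (simp add: real_div_sqrt field_simps)
  have q: "sqrt 3 * (sqrt 3 * t) = 3 * t" for t by (simp flip: mult.assoc)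
  show "cusp_rate 0 z = 1 / Im z" "cusp_rate 3 z = cusp_rate 0 z"
    unfolding cusp_rate_def s_star_simps \<Phi>_mult det2_divide by simp_all
  have "cusp_rate 1 z = (1/2 * ((1/2 - Re z * (sqrt 3 / 2))) - sqrt 3 / 2 * (Re z * (1/2) - ((Re z)\<^sup>2 + (Im z)\<^sup>2) * (sqrt 3 / 2))) / Im z"
    unfolding cusp_rate_def s_star_simps \<Phi>_mult det2_divide ..
  also have "\<dots> = 3/4 * ((Re z - 1 / sqrt 3)\<^sup>2 + (Im z)\<^sup>2) / Im z"
    unfolding s by (rule arg_cong[of _ _ "\<lambda>t. t / Im z"]) (simp add: power2_eq_square field_simps q)
  finally show "cusp_rate 1 z = 3/4 * ((Re z - 1 / sqrt 3)\<^sup>2 + (Im z)\<^sup>2) / Im z" .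
  have "cusp_rate 2 z = ((- 1/2) * ((- 1/2 - Re z * (sqrt 3 / 2))) - sqrt 3 / 2 * (Re z * (- 1/2) - ((Re z)\<^sup>2 + (Im z)\<^sup>2) * (sqrt 3 / 2))) / Im z"
    unfolding cusp_rate_def s_star_simps \<Phi>_mult det2_divide ..
  also have "\<dots> = 3/4 * ((Re z + 1 / sqrt 3)\<^sup>2 + (Im z)\<^sup>2) / Im z"
    unfolding s by (rule arg_cong[of _ _ "\<lambda>t. t / Im z"]) (simp add: power2_eq_square field_simps q)
  finally show "cusp_rate 2 z = 3/4 * ((Re z + 1 / sqrt 3)\<^sup>2 + (Im z)\<^sup>2) / Im z" .
qed

text \<open>The cost integrand is the sum of the three sweeping rates, so
  \<open>area_eq_sixth\<close> identifies the cost with the area.\<close>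

lemma trace_cusp_rate: "- (3/2) * trace (J_mat ** \<Phi> z) = cusp_rate 0 z + cusp_rate 1 z + cusp_rate 2 z"
proof -
  have "trace (J_mat ** \<Phi> z) = - (1 + (Re z)\<^sup>2 + (Im z)\<^sup>2) / Im z"
    by (simp add: trace_def J_mat_def \<Phi>_def matrix_matrix_mult_def sum_2 add_divide_distrib
        diff_divide_distrib)
  then have "- (3/2) * trace (J_mat ** \<Phi> z) = (3/2 * (1 + (Re z)\<^sup>2 + (Im z)\<^sup>2)) / Im z"
    by (simp only: minus_mult_minus times_divide_eq_right)
  also have "3/2 * (1 + (Re z)\<^sup>2 + (Im z)\<^sup>2)
    = 1 + 3/4 * ((Re z - 1 / sqrt 3)\<^sup>2 + (Im z)\<^sup>2) + 3/4 * ((Re z + 1 / sqrt 3)\<^sup>2 + (Im z)\<^sup>2)"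
    by (simp add: power2_diff power2_sum power_divide) (simp add: field_simps)
  finally show ?thesis by (simp add: cusp_rate_simps add_divide_distrib)
qed

text \<open>Serves to recognize \<open>z (t + tf)\<close> from its rates. Rate 0 gives the imaginary
  part, the difference of the other two the real part.\<close>

lemma cusp_rate_inject:
  assumes "Im z > 0" "Im w > 0" "cusp_rate 0 z = cusp_rate 0 w" "cusp_rate 1 z = cusp_rate 1 w"
    "cusp_rate 2 z = cusp_rate 2 w"
  shows "z = w"
proof -
  have im: "Im z = Im w" using assms by (simp add: cusp_rate_simps)
  have "(Re z - 1 / sqrt 3)\<^sup>2 = (Re w - 1 / sqrt 3)\<^sup>2" "(Re z + 1 / sqrt 3)\<^sup>2 = (Re w + 1 / sqrt 3)\<^sup>2"
    using assms im by (simp_all add: cusp_rate_simps)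
  then have "Re z * (1 / sqrt 3) = Re w * (1 / sqrt 3)"
    unfolding power2_sum power2_diff by argo
  then have "Re z = Re w" by simp
  with im show ?thesis by (simp add: complex_eq_iff)
qed

text \<open>With \<open>D\<close> the denominator, \<open>zm\<close>, \<open>zp\<close> and
  \<open>Dw\<close> say that the rotation sends infinity to \<open>d\<close>, \<open>d\<close> to
  \<open>- d\<close>, and \<open>- d\<close> to infinity; \<open>Im_z\<close> is the usual change of
  the imaginary part.\<close>

lemma lin_frac_R:
  assumes "Im w > 0"
  shows "Im (lin_frac R_mat w) > 0"
    and "cusp_rate 1 (lin_frac R_mat w) = cusp_rate 0 w"
    and "cusp_rate 2 (lin_frac R_mat w) = cusp_rate 1 w"
    and "cusp_rate 0 (lin_frac R_mat w) = cusp_rate 2 w"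
proof -
  define d where "d = 1 / sqrt 3"
  define h where "h = sqrt 3 / 2"
  have dh: "d * h = 1/2" by (simp add: d_def h_def)
  have dh': "d * (h * t) = t / 2" for t using dh by (simp flip: mult.assoc)
  have hh: "h * h = 3/4" by (simp add: h_def)
  have hd: "h + d / 2 = 2 * d" by (simp add: h_def d_def field_simps)
  have dd: "d\<^sup>2 = 1/3" by (simp add: d_def power_divide)
  define D where "D = complex_of_real h * w + of_real (1/2)"
  define z where "z = lin_frac R_mat w"
  have ImD: "Im D = h * Im w" "Re D = h * Re w + 1/2" by (simp_all add: D_def)
  have h0: "h > 0" by (simp add: h_def)
  then have "Im D > 0" using assms by (simp add: ImD)
  then have D0: "D \<noteq> 0" by auto
  have z: "z * D = of_real (1/2) * w - of_real h"
    using D0 by (simp add: z_def lin_frac_def R_mat_eq D_def h_def)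
  have rate0: "cusp_rate 1 u = 3/4 * (cmod (u - of_real d))\<^sup>2 / Im u"
    "cusp_rate 2 u = 3/4 * (cmod (u + of_real d))\<^sup>2 / Im u" for u
    by (simp_all add: cusp_rate_simps cmod_power2 d_def)
  have zm: "(z - of_real d) * D = - of_real (2 * d)"
  proof -
    have "(z - of_real d) * D = z * D - of_real d * D" by (simp add: left_diff_distrib)
    also have "\<dots> = - of_real (2 * d)" unfolding z
      using dh hd by (simp add: D_def complex_eq_iff dh' algebra_simps)
    finally show ?thesis .
  qed
  have zp: "(z + of_real d) * D = w - of_real d"
  proof -
    have "(z + of_real d) * D = z * D + of_real d * D" by (simp add: distrib_right)
    also have "\<dots> = w - of_real d" unfolding z
      using dh hd by (simp add: D_def complex_eq_iff dh' algebra_simps)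
    finally show ?thesis .
  qed
  have Dw: "D = of_real h * (w + of_real d)"
  proof -
    have "of_real h * of_real d = complex_of_real (1/2)"
      using dh by (simp only: mult.commute[of h] flip: of_real_mult)
    then show ?thesis by (simp add: D_def distrib_left)
  qed
  have Im_z: "Im z * (cmod D)\<^sup>2 = Im w"
  proof -
    have "of_real ((cmod D)\<^sup>2) * z = (z * D) * cnj D"
      by (simp only: complex_norm_square ac_simps)
    then have "Im (of_real ((cmod D)\<^sup>2) * z) = Im ((of_real (1/2) * w - of_real h) * cnj D)"
      by (simp only: z)
    also have "\<dots> = Im w * (1/4 + h * h)"
      by (simp add: ImD algebra_simps)
    finally show ?thesis by (simp add: hh mult.commute)
  qed
  have cD: "(cmod D)\<^sup>2 > 0" using D0 by simp
  then show "Im (lin_frac R_mat w) > 0"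
    using Im_z assms by (metis z_def zero_less_mult_pos2)
  have iz: "Im z = Im w / (cmod D)\<^sup>2" using Im_z cD by (simp add: field_simps)
  have "(cmod (z - of_real d))\<^sup>2 * (cmod D)\<^sup>2 = (2 * d)\<^sup>2"
    using arg_cong[OF zm, of "\<lambda>u. (cmod u)\<^sup>2"] by (simp add: norm_mult power_mult_distrib)
  then have a: "(cmod (z - of_real d))\<^sup>2 = (4/3) / (cmod D)\<^sup>2"
    using cD dd by (simp add: field_simps)
  have "(cmod (z + of_real d))\<^sup>2 * (cmod D)\<^sup>2 = (cmod (w - of_real d))\<^sup>2"
    using arg_cong[OF zp, of "\<lambda>u. (cmod u)\<^sup>2"] by (simp add: norm_mult power_mult_distrib)
  then have b: "(cmod (z + of_real d))\<^sup>2 = (cmod (w - of_real d))\<^sup>2 / (cmod D)\<^sup>2"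
    using cD by (simp add: field_simps)
  have c: "(cmod D)\<^sup>2 = 3/4 * (cmod (w + of_real d))\<^sup>2"
    using h0 hh by (simp add: Dw norm_mult power_mult_distrib power2_eq_square)
  show "cusp_rate 1 (lin_frac R_mat w) = cusp_rate 0 w"
    unfolding z_def[symmetric] rate0 a iz cusp_rate_simps(1) using cD by simp
  show "cusp_rate 2 (lin_frac R_mat w) = cusp_rate 1 w"
    unfolding z_def[symmetric] rate0 b iz using cD by simp
  show "cusp_rate 0 (lin_frac R_mat w) = cusp_rate 2 w"
    unfolding z_def[symmetric] rate0 iz cusp_rate_simps(1) c by simp
qed

lemma lin_frac_mult:
  assumes "of_real (B $ 2 $ 1) * w + of_real (B $ 2 $ 2) \<noteq> (0::complex)"
  shows "lin_frac (A ** B) w = lin_frac A (lin_frac B w)"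
proof -
  let ?c = complex_of_real
  define p where "p = ?c (B $ 1 $ 1) * w + ?c (B $ 1 $ 2)"
  define q where "q = ?c (B $ 2 $ 1) * w + ?c (B $ 2 $ 2)"
  have q0: "q \<noteq> 0" using assms by (simp add: q_def)
  have "lin_frac A (p / q) = ((?c (A $ 1 $ 1) * (p / q) + ?c (A $ 1 $ 2)) * q) / ((?c (A $ 2 $ 1) * (p / q) + ?c (A $ 2 $ 2)) * q)"
    using q0 by (simp add: lin_frac_def)
  also have "\<dots> = (?c (A $ 1 $ 1) * p + ?c (A $ 1 $ 2) * q) / (?c (A $ 2 $ 1) * p + ?c (A $ 2 $ 2) * q)"
    using q0 by (simp add: distrib_right)
  also have "\<dots> = lin_frac (A ** B) w"
    by (simp add: lin_frac_def p_def q_def matrix_matrix_mult_def sum_2 algebra_simps)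
  finally show ?thesis by (simp add: lin_frac_def p_def q_def)
qed

lemma lin_frac_R2:
  assumes "Im w > 0"
  shows "lin_frac (R_mat ** R_mat) w = lin_frac R_mat (lin_frac R_mat w)"
  by (rule lin_frac_mult) (use assms in \<open>auto simp: R_mat_eq complex_eq_iff\<close>)

section \<open>Proof of the theorem\<close>

text \<open>The matrix sending \<open>s_star 0\<close> to \<open>u\<close> and
  \<open>s_star 1\<close> to \<open>w\<close>; through it \<open>g\<close> inherits
  differentiability from \<sigma> 0 and \<sigma> 1.\<close>

definition cols :: "real^2 \<Rightarrow> real^2 \<Rightarrow> real^2^2" where
  "cols u w = (\<chi> i k. if k = 1 then u $ i else (w $ i - u $ i / 2) * (2 / sqrt 3))"

lemma cols_eq: "(A::real^2^2) = cols (A *v s_star 0) (A *v s_star 1)"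
  by (simp add: cols_def s_star_simps vec_eq_iff forall_2 matrix_vector_mult_def sum_2)

lemma has_vector_derivative_matrix:
  fixes A :: "real \<Rightarrow> real^2^2"
  assumes "((\<lambda>t. A t *v s_star 0) has_vector_derivative u) (at t)"
    and "((\<lambda>t. A t *v s_star 1) has_vector_derivative w) (at t)"
  shows "(A has_vector_derivative cols u w) (at t)"
proof -
  have lin1: "bounded_linear (\<lambda>u. cols u 0)" and lin2: "bounded_linear (\<lambda>w. cols 0 w)"
    unfolding linear_conv_bounded_linear[symmetric]
    by (rule linearI; simp add: cols_def vec_eq_iff algebra_simps diff_divide_distrib add_divide_distrib)+
  have sum: "cols u w = cols u 0 + cols 0 w" for u w
    by (simp add: cols_def vec_eq_iff algebra_simps)
  have "A = (\<lambda>t. cols (A t *v s_star 0) 0 + cols 0 (A t *v s_star 1))"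
    using cols_eq sum by metis
  moreover have "((\<lambda>t. cols (A t *v s_star 0) 0 + cols 0 (A t *v s_star 1))
    has_vector_derivative cols u 0 + cols 0 w) (at t)"
    by (intro has_vector_derivative_add bounded_linear.has_vector_derivative[OF lin1]
        bounded_linear.has_vector_derivative[OF lin2] assms)
  ultimately show ?thesis by (simp flip: sum)
qed

locale star_trajectory = balanced_curve K \<sigma> tf for K \<sigma> tf +
  fixes g X :: "real \<Rightarrow> real^2^2" and z :: "real \<Rightarrow> complex"
  assumes trajectory: "boundary_trajectory K \<sigma> tf g X"
    and in_star: "\<And>t. z t \<in> star_domain"
    and X_eq: "\<And>t. X t = \<Phi> (z t)"
begin

lemma det_g: "det (g t) = 1" and curve_eq: "\<sigma> j t = g t *v s_star j" and det_X: "det (X t) = 1"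
  using trajectory by (auto simp: boundary_trajectory_def)

lemma inverse_g: "matrix_inv (g t) ** g t = mat 1" "g t ** matrix_inv (g t) = mat 1"
proof -
  have "invertible (g t)" using det_g[of t] by (simp add: invertible_det_nz)
  then have "g t ** matrix_inv (g t) = mat 1 \<and> matrix_inv (g t) ** g t = mat 1"
    unfolding invertible_def matrix_inv_def by (rule someI_ex)
  then show "matrix_inv (g t) ** g t = mat 1" "g t ** matrix_inv (g t) = mat 1" by simp_all
qed

lemma det_inverse_g: "det (matrix_inv (g t)) = 1"
  using arg_cong[OF inverse_g(1), of det t] det_g[of t] by (simp add: det_mul)

lemma g_deriv: "(g has_vector_derivative cols (vel 0 t) (vel 1 t)) (at t)"
  by (rule has_vector_derivative_matrix) (use has_vel[of 0 t] has_vel[of 1 t] in \<open>simp_all add: curve_eq[symmetric]\<close>)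

lemma X_deriv: "X t = matrix_inv (g t) ** cols (vel 0 t) (vel 1 t)"
  using trajectory vector_derivative_at[OF g_deriv] by (simp add: boundary_trajectory_def)

lemma vel_eq: "vel j t = g t *v (X t *v s_star j)"
proof -
  have "bounded_linear (\<lambda>A::real^2^2. A *v s_star j)"
    unfolding linear_conv_bounded_linear[symmetric]
    by (rule linearI) (simp_all add: matrix_vector_mult_add_rdistrib scaleR_matrix_vector_assoc)
  from bounded_linear.has_vector_derivative[OF this g_deriv]
  have "(\<sigma> j has_vector_derivative cols (vel 0 t) (vel 1 t) *v s_star j) (at t)"
    by (simp flip: curve_eq)
  then have "vel j t = cols (vel 0 t) (vel 1 t) *v s_star j"
    using has_vel vector_derivative_unique_at by blast
  then show ?thesis
    by (simp add: X_deriv matrix_vector_mul_assoc matrix_mul_assoc inverse_g)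
qed

lemma Im_z: "Im (z t) > 0"
  using in_star[of t] by (simp add: star_domain_def upper_half_plane_def)

end

sublocale star_trajectory \<subseteq> normalized_curve K \<sigma> tf
proof
  fix j t
  have "pi * of_int (j + 1) / 3 - pi * of_int j / 3 = pi / 3" by (simp add: field_simps)
  then have "det2 (s_star j) (s_star (j + 1)) = sqrt 3 / 2"
    by (simp only: s_star_eq det2_circle_point sin_60)
  then show "det2 (vel j t) (vel (j + 1) t) = sqrt 3 / 2"
    by (simp add: vel_eq det2_matrix det_g det_X)
qed

context star_trajectory
begin

lemma rate_eq: "rate j t = cusp_rate j (z t)"
  by (simp add: rate_def cusp_rate_def curve_eq vel_eq det2_matrix det_g X_eq)

lemma cusp_rate_shift: "cusp_rate j (z (t + tf)) = cusp_rate (j + 1) (z t)"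
  unfolding rate_eq[symmetric] by (simp add: rate_def shift vel_shift)

lemma cost_eq_area: "trajectory_cost X tf = area K"
proof -
  have "trajectory_cost X tf = integral {0..tf} (\<lambda>t. - (3/2) * trace (J_mat ** X t))"
    unfolding trajectory_cost_def by (rule integral_mult_right[symmetric])
  also have "\<dots> = integral {0..tf} (\<lambda>t. rate 0 t + rate 1 t + rate 2 t)"
    by (simp only: X_eq trace_cusp_rate rate_eq)
  also have "\<dots> = integral {0..tf} (rate 0) + integral {0..tf} (rate 1) + integral {0..tf} (rate 2)"
    by (simp add: integral_add integrable_add rate_integrable)
  also have "\<dots> = area K" using area_eq_sixth[of 0] by (simp add: area_def)
  finally show ?thesis .
qed

lemma framed: "framed_curve K \<sigma> tf a (Re (z a)) (Im (z a)) (matrix_inv (g a))"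
proof
  show "det (matrix_inv (g a)) = 1" by (rule det_inverse_g)
  show "Im (z a) > 0" by (rule Im_z)
  have c: "matrix_inv (g a) *v (g a *v u) = u" for u
    by (simp add: matrix_vector_mul_assoc inverse_g)
  show "matrix_inv (g a) *v \<sigma> 0 a = vector [1, 0]"
    "matrix_inv (g a) *v \<sigma> 1 a = vector [1 / 2, sqrt 3 / 2]"
    by (simp_all add: curve_eq c s_star_simps)
  show "matrix_inv (g a) *v vel 0 a = vector [Re (z a) / Im (z a), 1 / Im (z a)]"
    "matrix_inv (g a) *v vel 1 a
      = vector [(Re (z a) / 2 - ((Re (z a))\<^sup>2 + (Im (z a))\<^sup>2) * (sqrt 3 / 2)) / Im (z a),
          (1 / 2 - Re (z a) * (sqrt 3 / 2)) / Im (z a)]"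
    by (simp_all add: vel_eq c X_eq s_star_simps \<Phi>_mult)
qed

lemma Re_z: "\<bar>Re (z t)\<bar> < 1 / sqrt 3"
  using in_star[of t] by (simp add: star_domain_def)

lemma cusp_reached_or_wall:
  assumes "z t \<notin> compact_star_domain"
  obtains s where "Im (z s) > 9/2" | s where "z s \<in> Pi0_plus"
proof -
  \<comment> \<open>All three horoballs have the form "a cusp rate is below 2/9"; for the disks,
    \<open>2/9 = 3/4 * 8/27\<close>.\<close>
  have ball: "3/4 * ((Re w - c)\<^sup>2 + (Im w)\<^sup>2) / Im w < 2/9" if "w \<in> B_cusp c" "Im w > 0" for w c
  proof -
    have "(cmod (w - Complex c (4/27)))\<^sup>2 < (4/27)\<^sup>2"
      using that(1) by (intro power_strict_mono) (auto simp: B_cusp_def dist_norm norm_minus_commute)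
    then have "(Re w - c)\<^sup>2 + (Im w - 4/27)\<^sup>2 < (4/27)\<^sup>2" by (simp add: cmod_power2)
    then have "(Re w - c)\<^sup>2 + (Im w)\<^sup>2 < 8/27 * Im w" by (simp add: power2_diff)
    then show ?thesis using that(2) by (simp add: pos_divide_less_eq)
  qed
  have high: "Im (z s) > 9/2" if "cusp_rate 0 (z s) < 2/9" for s
    using that Im_z[of s] by (simp add: cusp_rate_simps field_simps)
  \<comment> \<open>A time shift by \<open>tf\<close> acts on the trajectory as the inverse of
    \<open>R_mat\<close>.\<close>
  have rot: "z (s + tf) = w" if "z s = lin_frac R_mat w" "Im w > 0" for s w
    using that Im_z[of "s + tf"] cusp_rate_shift[of 0 s] cusp_rate_shift[of 1 s] cusp_rate_shift[of 2 s]
    by (intro cusp_rate_inject) (simp_all add: lin_frac_R cusp_rate_simps(4))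
  consider "z t \<in> B_infinity" | "z t \<in> B_cusp (1 / sqrt 3)" | "z t \<in> B_cusp (- 1 / sqrt 3)"
    | "z t \<in> Pi0_plus" | "z t \<in> Pi1_plus" | "z t \<in> Pi2_plus"
    using assms in_star[of t] by (auto simp: compact_star_domain_def)
  then show thesis
  proof cases
    case 1
    then show thesis using that(1) by (simp add: B_infinity_def)
  next
    case 2
    have "cusp_rate 0 (z (t + tf)) < 2/9"
      using ball[OF 2 Im_z] cusp_rate_shift[of 0 t] by (simp add: cusp_rate_simps)
    then show thesis using high that(1) by blast
  next
    case 3
    have "cusp_rate 0 (z (t + tf + tf)) < 2/9"
      using ball[OF 3 Im_z] cusp_rate_shift[of 0 "t + tf"] cusp_rate_shift[of 1 t]
      by (simp add: cusp_rate_simps)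
    then show thesis using high that(1) by blast
  next
    case 4
    then show thesis using that(2) by blast
  next
    case 5
    then obtain w where w: "w \<in> Pi0_plus" "z t = lin_frac R_mat w" by (auto simp: Pi1_plus_def)
    then have "z (t + tf) = w" by (intro rot) (auto simp: Pi0_plus_def upper_half_plane_def)
    then show thesis using w(1) that(2) by blast
  next
    case 6
    then obtain w where w: "w \<in> Pi0_plus" "z t = lin_frac (R_mat ** R_mat) w" by (auto simp: Pi2_plus_def)
    then have Im: "Im w > 0" by (simp add: Pi0_plus_def upper_half_plane_def)
    have "z (t + tf) = lin_frac R_mat w"
      by (rule rot[OF _ lin_frac_R(1)[OF Im]]) (simp add: w(2) lin_frac_R2[OF Im])
    then have "z (t + tf + tf) = w" by (rule rot[OF _ Im])
    then show thesis using w(1) that(2) by blast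
  qed
qed

lemma area_greater_pi:
  assumes "z t \<notin> compact_star_domain"
  shows "area K > pi"
proof -
  have high: ?thesis if "Im (z s) > 9/2" for s
    using framed_curve.area_cusp[OF framed that Re_z] pi_less by (simp add: area_def)
  from assms show ?thesis
  proof (cases rule: cusp_reached_or_wall)
    case (1 s)
    then show ?thesis by (rule high)
  next
    case (2 s)
    show ?thesis
    proof (cases "\<exists>u. Im (z u) > 9/2")
      case True
      then show ?thesis using high by blast
    next
      case False
      then have low: "Im (z u) \<le> 9/2" for u by (simp add: not_less)
      \<comment> \<open>Staying below the horoball at infinity at the later time
        \<open>s + tf\<close> means staying out of the one at \<open>1 / sqrt 3\<close> at time
        \<open>s\<close>.\<close>
      have "cusp_rate 0 (z (s + tf)) \<ge> 2/9"
        using low[of "s + tf"] Im_z[of "s + tf"] by (simp add: cusp_rate_simps field_simps)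
      then have "cusp_rate 1 (z s) \<ge> 2/9" using cusp_rate_shift[of 0 s] by simp
      then have "(Re (z s) - 1 / sqrt 3)\<^sup>2 + (Im (z s))\<^sup>2 \<ge> 8/27 * Im (z s)"
        using Im_z[of s] by (simp add: cusp_rate_simps pos_le_divide_eq)
      moreover have "Im (z s) > 15 * (1 / sqrt 3 - Re (z s))" using 2 by (simp add: Pi0_plus_def)
      moreover have "Re (z s) < 1 / sqrt 3" using Re_z[of s] by simp
      ultimately show ?thesis
        using framed_curve.area_wall[OF framed, of s] low[of s] pi_less by (simp add: area_def)
    qed
  qed
qed

end

theorem theorem5p0p2:
  fixes K :: "(real^2) set"
    and \<sigma> :: "int \<Rightarrow> real \<Rightarrow> real^2"
    and tf :: real
    and g X :: "real \<Rightarrow> real^2^2"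
    and z :: "real \<Rightarrow> complex"
  assumes "balanced_disk K"
    and "boundary_trajectory K \<sigma> tf g X"
    and "\<forall>t. z t \<in> star_domain"
    and "\<Phi> \<circ> z = X"
    and "\<exists>t. z t \<notin> compact_star_domain"
  shows "trajectory_cost X tf = area K
       \<and> trajectory_cost X tf > smoothed_octagon_area
       \<and> \<not> global_area_minimizer K"
proof -
  interpret star_trajectory K \<sigma> tf g X z
    using assms unfolding balanced_disk_def boundary_trajectory_def
    by unfold_locales (auto simp: boundary_trajectory_def)
  obtain t where "z t \<notin> compact_star_domain" using assms(5) by blast
  then have "area K > pi" by (rule area_greater_pi)
  then show ?thesis
    using cost_eq_area smoothed_octagon_area_less_pi unit_disk_balanced area_unit_disk
    unfolding global_area_minimizer_def by (metis less_trans not_le)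
qed

end
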